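(* Let $r\ge 3$ be an integer, $d>0$ a real number, $(d_n)_{n\in\mathbb{N}}$ a sequence of reals with $d_n\to d$, and $p=p(n)=d_n/\binom{n-1}{r-1}$. Let $L_P$ be the length of the longest loose path in $H=H^r(n,p)$. Then with high probability $$L_P\le \left(\min\{\beta,\gamma\}+o(1)\right)\cdot n,$$ where, with $\rho_*$ and $\hat\rho_*$ as defined in the context, $$\beta=\frac{d}{r}\left(1-(1-\rho_* )^r-r\rho_*(1-\rho_* )^{r-1}\right),\qquad \gamma=1-\exp(-d\hat\rho_* )-d\hat\rho_*\exp(-d\hat\rho_* ).$$
   Context: Asymptotics are as $n\to\infty$; "with high probability" means with probability tending to $1$ as $n\to\infty$. $H^r(n,p)$ is the random $r$-uniform hypergraph on vertex set $[n]$ in which each $r$-subset of $[n]$ is an edge independently with probability $p$. A loose path of length $\ell$ in an $r$-uniform hypergraph is a sequence of distinct vertices $v_1,\dots,v_{\ell(r-1)+1}$ and a sequence of edges $e_1,\dots,e_\ell$ with $e_i=\{v_{(i-1)(r-1)+1},\dots,v_{(i-1)(r-1)+r}\}$ for $i\in[\ell]$. Let $F(x)=\exp(-d(1-x^{r-1}))$ for $x\ge 0$; $\rho_*=\rho_*(r,d)$ is the largest solution $\rho$ of $1-\rho=F(1-\rho)$ (note $\rho=0$ is always a solution), and $\hat\rho_*=1-(1-\rho_* )^{r-1}$. *)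

theory Defs
  imports "HOL-Probability.Probability"
begin

section \<open>The random hypergraph\<close>

definition r_subsets :: "nat \<Rightarrow> nat \<Rightarrow> nat set set" where
  "r_subsets r n = {e. e \<subseteq> {1..n} \<and> card e = r}"

text \<open>
  An \<open>r\<close>-uniform hypergraph on \<open>{1..n}\<close> is represented by its set of edges.
  \<^const>\<open>bernoulli_pmf\<close> truncates its parameter to the unit interval, so the distribution is
  the intended one whenever \<open>p\<close> is a probability.
\<close>

definition random_hypergraph :: "nat \<Rightarrow> nat \<Rightarrow> real \<Rightarrow> nat set set pmf" where
  "random_hypergraph r n p =
     map_pmf (\<lambda>X. {e \<in> r_subsets r n. X e})
       (Pi_pmf (r_subsets r n) False (\<lambda>_. bernoulli_pmf p))"


section \<open>Loose paths\<close>

text \<open>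
  \<open>v\<close> is relevant only on the indices \<open>1, \<dots>, l (r - 1) + 1\<close> and \<open>e\<close> only on \<open>1, \<dots>, l\<close>.
  For \<open>l = 0\<close> this is a single vertex.
\<close>

definition loose_path ::
  "nat \<Rightarrow> 'a set \<Rightarrow> 'a set set \<Rightarrow> nat \<Rightarrow> (nat \<Rightarrow> 'a) \<Rightarrow> (nat \<Rightarrow> 'a set) \<Rightarrow> bool" where
  "loose_path r V E l v e \<longleftrightarrow>
     inj_on v {1..l * (r - 1) + 1} \<and> v ` {1..l * (r - 1) + 1} \<subseteq> V \<and>
     (\<forall>i\<in>{1..l}. e i \<in> E \<and> e i = v ` {(i - 1) * (r - 1) + 1..(i - 1) * (r - 1) + r})"

definition longest_loose_path :: "nat \<Rightarrow> 'a set \<Rightarrow> 'a set set \<Rightarrow> nat" where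
  "longest_loose_path r V E = Max {l. \<exists>v e. loose_path r V E l v e}"

text \<open>The maximum is over a finite nonempty set as soon as \<open>V\<close> is finite and nonempty.\<close>

lemma loose_path_lengths_finite:
  assumes "r \<ge> 2" "finite V"
  shows "finite {l. \<exists>v e. loose_path r V E l v e}"
proof (rule finite_subset)
  show "{l. \<exists>v e. loose_path r V E l v e} \<subseteq> {..card V}"
  proof safe
    fix l v e assume "loose_path r V E l v e"
    then have "l * (r - 1) + 1 \<le> card V"
      using card_inj_on_le[of v "{1..l * (r - 1) + 1}" V] assms by (auto simp: loose_path_def)
    moreover have "l * 1 \<le> l * (r - 1)" using assms by (intro mult_le_mono) auto
    ultimately show "l \<le> card V" by linarith
  qed
qed simp

lemma loose_path_lengths_nonempty:
  assumes "V \<noteq> {}"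
  shows "0 \<in> {l. \<exists>v e. loose_path r V E l v e}"
proof -
  obtain x where "x \<in> V" using assms by blast
  then have "loose_path r V E 0 (\<lambda>_. x) (\<lambda>_. {})" by (auto simp: loose_path_def)
  then show ?thesis by blast
qed


section \<open>The constants\<close>

definition F_fun :: "nat \<Rightarrow> real \<Rightarrow> real \<Rightarrow> real" where
  "F_fun r d x = exp (- d * (1 - x ^ (r - 1)))"

text \<open>The condition \<open>0 \<le> 1 - \<rho>\<close> restricts \<^const>\<open>F_fun\<close> to its domain, the nonnegative reals.\<close>

definition rho_star :: "nat \<Rightarrow> real \<Rightarrow> real" where
  "rho_star r d = (GREATEST \<rho>. 0 \<le> 1 - \<rho> \<and> 1 - \<rho> = F_fun r d (1 - \<rho>))"

text \<open>The largest solution exists.\<close>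

lemma rho_star_greatest:
  shows "0 \<le> 1 - rho_star r d" (is ?A)
    and "1 - rho_star r d = F_fun r d (1 - rho_star r d)" (is ?B)
    and "\<And>\<rho>. 0 \<le> 1 - \<rho> \<Longrightarrow> 1 - \<rho> = F_fun r d (1 - \<rho>) \<Longrightarrow> \<rho> \<le> rho_star r d"
proof -
  define S where "S = {\<rho> \<in> {0..1}. 1 - \<rho> = F_fun r d (1 - \<rho>)}"
  have "S = {0..1} \<inter> {\<rho>. 1 - \<rho> = F_fun r d (1 - \<rho>)}"
    by (auto simp: S_def)
  moreover have "closed {\<rho>. 1 - \<rho> = F_fun r d (1 - \<rho>)}"
    unfolding F_fun_def by (intro closed_Collect_eq continuous_intros)
  ultimately have "compact S" by (simp add: compact_Int_closed)
  moreover have "0 \<in> S" by (simp add: S_def F_fun_def)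
  ultimately obtain m where m: "m \<in> S" "\<forall>t\<in>S. t \<le> m"
    using compact_attains_sup[of S] by blast
  have max: "y \<le> m" if "0 \<le> 1 - y \<and> 1 - y = F_fun r d (1 - y)" for y
  proof (cases "y \<ge> 0")
    case True
    then show ?thesis using that m(2) by (auto simp: S_def)
  next
    case False
    then show ?thesis using m(1) by (auto simp: S_def)
  qed
  have "rho_star r d = m"
    unfolding rho_star_def using m(1) max by (intro Greatest_equality) (auto simp: S_def)
  then show ?A ?B "\<And>\<rho>. 0 \<le> 1 - \<rho> \<Longrightarrow> 1 - \<rho> = F_fun r d (1 - \<rho>) \<Longrightarrow> \<rho> \<le> rho_star r d"
    using m(1) max by (auto simp: S_def)
qed

definition rho_hat_star :: "nat \<Rightarrow> real \<Rightarrow> real" where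
  "rho_hat_star r d = 1 - (1 - rho_star r d) ^ (r - 1)"

definition path_beta :: "nat \<Rightarrow> real \<Rightarrow> real" where
  "path_beta r d = d / real r *
     (1 - (1 - rho_star r d) ^ r - real r * rho_star r d * (1 - rho_star r d) ^ (r - 1))"

definition path_gamma :: "nat \<Rightarrow> real \<Rightarrow> real" where
  "path_gamma r d = 1 - exp (- d * rho_hat_star r d)
     - d * rho_hat_star r d * exp (- d * rho_hat_star r d)"

end

theory Submission
  imports Defs
begin

text \<open>
  An edge in the interior of a loose path has two vertices from which the path continues for \<open>k\<close>
  further edges, disjointly and without using the edge itself; likewise two consecutive edges
  of the path continue disjointly for \<open>k\<close> steps beyond their common vertex. The length of the path is
  therefore, up to \<open>2 k + 1\<close>, at most the number of edges with the first property and at most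
  the number of vertices with the second one.

  Only upper bounds on the probabilities of these increasing events are needed, so no coupling
  with a branching process is required: the van den Berg--Kesten inequality, in the form that
  duplicates each variable for all the events involved, bounds them by the corresponding
  probabilities for independent branches. This yields the recursion \<open>1 - \<rho> \<mapsto> F (1 - \<rho>)\<close>, whose
  iterates started at \<open>\<rho> = 1\<close> decrease to \<open>\<rho>\<^sub>*\<close>.
  The same inequality controls covariances: two such local events are negatively correlated apart
  from the event that their neighbourhoods meet, which contributes only \<open>O(n)\<close> to the variance of
  the counts. Chebyshev's inequality then gives concentration.
\<close>

section \<open>Random subsets and disjoint occurrence\<close>

text \<open>\<open>reach\<close> and \<open>branch\<close> forbid repeated edges but not repeated
  vertices. Edge-disjointness is exactly what disjoint occurrence in a random edge set expresses,
  and forgetting vertex-disjointness only enlarges the events, so short cycles need no separate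
  treatment. Both constants come from one event, "at least two succeed". Among the \<open>r\<close>
  vertices of an edge, with about \<open>d / r\<close> edges per vertex, it gives
  \<open>path_beta\<close>; among the asymptotically Poisson number of branches at a vertex, with
  mean \<open>d * rho_hat_star r d\<close>, it gives \<open>path_gamma\<close>. The depth
  \<open>k\<close> is fixed while \<open>n\<close> tends to infinity, because the variance bound may
  grow exponentially with \<open>k\<close>; how small a slack can be afforded therefore depends on
  \<open>n\<close>, and the \<open>o(1)\<close> needs a diagonal argument at the end. The delicate
  count is that of edges: there are \<open>(n * N / r)\<^sup>2\<close> pairs, where \<open>N\<close>
  is the number of potential edges at a vertex, so a covariance bound has to retain a factor
  \<open>p\<^sup>2\<close> beside the probability of a connection.\<close>

lemma prob_bind_pmf:
  "measure_pmf.prob (bind_pmf M f) A = measure_pmf.expectation M (\<lambda>x. measure_pmf.prob (f x) A)"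
proof -
  have int: "integrable (measure_pmf M) (\<lambda>x. measure_pmf.prob (f x) A)"
    by (rule measure_pmf.integrable_const_bound[where B = 1]) auto
  have "ennreal (measure_pmf.prob (bind_pmf M f) A) = (\<integral>\<^sup>+x. emeasure (f x) A \<partial>M)"
    by (subst measure_pmf.emeasure_eq_measure[symmetric]) simp
  also have "\<dots> = (\<integral>\<^sup>+x. ennreal (measure_pmf.prob (f x) A) \<partial>M)"
    by (simp add: measure_pmf.emeasure_eq_measure)
  also have "\<dots> = ennreal (measure_pmf.expectation M (\<lambda>x. measure_pmf.prob (f x) A))"
    by (rule nn_integral_eq_integral[OF int]) simp
  finally show ?thesis
    by (subst (asm) ennreal_inj) (auto intro: Bochner_Integration.integral_nonneg)
qed

lemma integrable_bounded_pmf: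
  fixes f :: "'a \<Rightarrow> real"
  assumes "\<And>x. \<bar>f x\<bar> \<le> B"
  shows "integrable (measure_pmf M) f"
  by (rule measure_pmf.integrable_const_bound[where B = B]) (use assms in auto)

lemma prob_bernoulli_mixture:
  assumes "0 \<le> p" "p \<le> 1"
  shows "measure_pmf.prob (bind_pmf (bernoulli_pmf p) f) A =
           p * measure_pmf.prob (f True) A + (1 - p) * measure_pmf.prob (f False) A"
  using assms by (simp add: prob_bind_pmf)

lemma bernoulli_mixture:
  assumes "0 \<le> p" "p \<le> 1" "0 \<le> a" "a \<le> 1" "0 \<le> b" "b \<le> 1"
  shows "bind_pmf (bernoulli_pmf p) (\<lambda>t. bernoulli_pmf (if t then a else b))
           = bernoulli_pmf (p * a + (1 - p) * b)"
proof (rule pmf_eqI)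
  fix i
  have 1: "p * a + (1 - p) * b \<le> 1"
    using convex_bound_le[of a 1 b p "1 - p"] assms by simp
  have 2: "0 \<le> p * a + (1 - p) * b" using assms by simp
  show "pmf (bind_pmf (bernoulli_pmf p) (\<lambda>t. bernoulli_pmf (if t then a else b))) i =
        pmf (bernoulli_pmf (p * a + (1 - p) * b)) i"
    using assms 1 2 by (cases i) (simp_all add: pmf_bind algebra_simps)
qed

definition random_subset :: "'a set \<Rightarrow> real \<Rightarrow> 'a set pmf" where
  "random_subset X p = map_pmf (\<lambda>f. {x\<in>X. f x}) (Pi_pmf X False (\<lambda>_. bernoulli_pmf p))"

lemma random_subset_subset: "S \<in> set_pmf (random_subset X p) \<Longrightarrow> S \<subseteq> X"
  by (auto simp: random_subset_def)

lemma random_subset_empty [simp]: "random_subset {} p = return_pmf {}"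
  by (simp add: random_subset_def)

lemma random_subset_insert:
  assumes "finite X" "x \<notin> X"
  shows "random_subset (insert x X) p =
           bind_pmf (bernoulli_pmf p) (\<lambda>b. map_pmf (\<lambda>S. if b then insert x S else S) (random_subset X p))"
proof -
  have *: "{y. (y = x \<or> y \<in> X) \<and> (f(x := b)) y}
            = (if b then insert x {y\<in>X. f y} else {y\<in>X. f y})" for f b
    using assms(2) by auto
  show ?thesis
    using assms unfolding random_subset_def
    by (simp add: Pi_pmf_insert' map_bind_pmf pmf.map_comp o_def map_pmf_def[symmetric] * del: fun_upd_apply)
qed

lemma prob_mono:
  assumes "\<And>S. S \<in> set_pmf M \<Longrightarrow> P S \<Longrightarrow> Q S"
  shows "measure_pmf.prob M {S. P S} \<le> measure_pmf.prob M {S. Q S}"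
  by (rule measure_pmf.finite_measure_mono_AE) (use assms in \<open>auto simp: AE_measure_pmf_iff\<close>)

lemma prob_cong:
  assumes "\<And>S. S \<in> set_pmf M \<Longrightarrow> P S \<longleftrightarrow> Q S"
  shows "measure_pmf.prob M {S. P S} = measure_pmf.prob M {S. Q S}"
  by (intro antisym prob_mono) (use assms in auto)

lemma prob_random_subset_insert:
  assumes "finite X" "x \<notin> X" "0 \<le> p" "p \<le> 1"
  shows "measure_pmf.prob (random_subset (insert x X) p) {S. P S} =
           p * measure_pmf.prob (random_subset X p) {S. P (insert x S)}
           + (1 - p) * measure_pmf.prob (random_subset X p) {S. P S}"
  using assms by (simp add: random_subset_insert prob_bernoulli_mixture vimage_def)

text \<open>The set \<open>S - {x}\<close> is independent of the presence of \<open>x\<close>.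
  Factors \<open>p\<close> for edges are extracted in this form, which is why the recursive
  definitions delete an edge once it is used.\<close>

lemma prob_member_and_rest:
  assumes "finite X" "x \<in> X" "0 \<le> p" "p \<le> 1"
  shows "measure_pmf.prob (random_subset X p) {S. x \<in> S \<and> P (S - {x})} =
           p * measure_pmf.prob (random_subset X p) {S. P (S - {x})}"
proof -
  define Y where "Y = X - {x}"
  have X: "X = insert x Y" "finite Y" "x \<notin> Y" using assms by (auto simp: Y_def)
  have "x \<notin> S" if "S \<in> set_pmf (random_subset Y p)" for S
    using random_subset_subset[OF that] X by auto
  then have "measure_pmf.prob (random_subset Y p) {S. x \<in> S \<and> P (S - {x})}
      = measure_pmf.prob (random_subset Y p) {S. False}"
    by (intro prob_cong) auto
  then show ?thesis
    unfolding X(1) using X assms by (simp add: prob_random_subset_insert algebra_simps)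
qed

text \<open>\<open>J\<close> lists the admissible index sets, so one notion covers two given events
  as well as one or two out of many. For increasing events the witness \<open>K i\<close> already
  forces \<open>A i S\<close>.\<close>

definition disjointly :: "'i set set \<Rightarrow> ('i \<Rightarrow> 'a set \<Rightarrow> bool) \<Rightarrow> 'a set \<Rightarrow> bool" where
  "disjointly J A S \<longleftrightarrow>
     (\<exists>T\<in>J. \<exists>K. disjoint_family_on K T \<and> (\<forall>i\<in>T. K i \<subseteq> S \<and> A i (K i)))"

definition some_all :: "'i set set \<Rightarrow> ('i \<Rightarrow> bool) set" where
  "some_all J = {f. \<exists>T\<in>J. \<forall>i\<in>T. f i}"

text \<open>
  Give every event its own independent copy of the variable \<open>x\<close>. Disjoint witnesses use \<open>x\<close> for
  at most one of the events, so whenever \<open>x\<close> is pivotal it suffices that this event's copy is on.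
\<close>

lemma disjointly_split:
  assumes "finite I" "J \<subseteq> Pow I" "x \<notin> S" "0 \<le> p" "p \<le> 1"
    and mono: "\<And>i K K'. i \<in> I \<Longrightarrow> A i K \<Longrightarrow> K \<subseteq> K' \<Longrightarrow> A i K'"
  shows "p * of_bool (disjointly J A (insert x S)) + (1 - p) * of_bool (disjointly J A S)
     \<le> measure_pmf.prob (Pi_pmf I False (\<lambda>_. bernoulli_pmf p))
         {b. disjointly J (\<lambda>i K. A i (if b i then insert x K else K)) S}"
    (is "_ \<le> measure_pmf.prob ?M {b. ?D b}")
proof (cases "disjointly J A S")
  case True
  have "?D b" for b
    using True mono assms(2) unfolding disjointly_def
    by (smt (verit) Pow_iff subsetD subset_insertI)
  then have "measure_pmf.prob ?M {b. ?D b} = 1" by simp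
  then show ?thesis using assms(4,5) by (auto simp: of_bool_def)
next
  case D0: False
  show ?thesis
  proof (cases "disjointly J A (insert x S)")
    case False
    then show ?thesis using D0 by simp
  next
    case True
    then obtain T K where T: "T \<in> J" "disjoint_family_on K T"
        "\<And>i. i \<in> T \<Longrightarrow> K i \<subseteq> insert x S" "\<And>i. i \<in> T \<Longrightarrow> A i (K i)"
      unfolding disjointly_def by blast
    obtain j where j: "j \<in> T" "x \<in> K j"
      using D0 T unfolding disjointly_def by (metis subset_insert)
    have TI: "T \<subseteq> I" using T(1) assms(2) by auto
    have only: "x \<notin> K i" if "i \<in> T" "i \<noteq> j" for i
      using T(2) j that unfolding disjoint_family_on_def by blast
    have "?D b" if "b j" for b
    proof -
      have "disjoint_family_on (\<lambda>i. K i - {x}) T"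
        using T(2) unfolding disjoint_family_on_def by blast
      moreover have "K i - {x} \<subseteq> S" if "i \<in> T" for i using T(3)[OF that] by auto
      moreover have "A i (if b i then insert x (K i - {x}) else K i - {x})" if "i \<in> T" for i
        using T(4)[OF that] only[OF that] \<open>b j\<close> j(2) mono[of i "K i"] that TI
        by (cases "i = j") (auto simp: insert_absorb)
      ultimately show ?thesis unfolding disjointly_def using T(1)
        by (intro bexI[of _ T] exI[of _ "\<lambda>i. K i - {x}"]) auto
    qed
    then have "measure_pmf.prob ?M {b. b j} \<le> measure_pmf.prob ?M {b. ?D b}"
      by (intro prob_mono) auto
    moreover have "measure_pmf.prob ?M {b. b j} = measure_pmf.prob (map_pmf (\<lambda>b. b j) ?M) {True}"
      by (simp add: vimage_def)
    moreover have "\<dots> = p"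
      using assms(1,4,5) j TI by (subst Pi_pmf_component) (auto simp: measure_pmf_single)
    ultimately show ?thesis using D0 True by simp
  qed
qed

lemma Pi_pmf_bernoulli_mixture:
  assumes "finite I" "0 \<le> p" "p \<le> 1" "\<And>i. a i \<in> {0..1}" "\<And>i. b i \<in> {0..1}"
  shows "bind_pmf (Pi_pmf I False (\<lambda>_. bernoulli_pmf p))
            (\<lambda>t. Pi_pmf I False (\<lambda>i. bernoulli_pmf (if t i then a i else b i)))
         = Pi_pmf I False (\<lambda>i. bernoulli_pmf (p * a i + (1 - p) * b i))"
  using assms Pi_pmf_bind[OF assms(1), of False "\<lambda>_. bernoulli_pmf p"
      "\<lambda>i t. bernoulli_pmf (if t then a i else b i)" False]
  by (simp add: bernoulli_mixture)

text \<open>Induction on the ground set. The new element is replaced by one independent copy per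
  event; with the copies frozen, the induction hypothesis is applied to the modified events, hence
  the generalisation over \<open>A\<close>.\<close>

theorem disjointly_prob_le:
  assumes "finite X" "finite I" "J \<subseteq> Pow I" "0 \<le> p" "p \<le> 1"
    and "\<And>i K K'. i \<in> I \<Longrightarrow> A i K \<Longrightarrow> K \<subseteq> K' \<Longrightarrow> A i K'"
  shows "measure_pmf.prob (random_subset X p) {S. disjointly J A S} \<le>
         measure_pmf.prob (Pi_pmf I False
            (\<lambda>i. bernoulli_pmf (measure_pmf.prob (random_subset X p) {S. A i S}))) (some_all J)"
  using assms(1,6)
proof (induction X arbitrary: A rule: finite_induct)
  case empty
  have *: "bernoulli_pmf (of_bool (A i {})) = return_pmf (A i {})" for i
    by (rule pmf_eqI) (auto simp: indicator_def split: bool.split)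
  have "disjointly J A {} \<longleftrightarrow> (\<exists>T\<in>J. \<forall>i\<in>T. A i {})"
    unfolding disjointly_def subset_empty by (intro bex_cong refl iffI) (auto simp: disjoint_family_on_def)
  moreover have "(\<exists>T\<in>J. \<forall>i\<in>T. i \<in> I \<and> A i {}) \<longleftrightarrow> (\<exists>T\<in>J. \<forall>i\<in>T. A i {})"
    using assms(3) by blast
  ultimately show ?case using assms(2)
    by (simp add: * some_all_def indicator_def) blast
next
  case (insert x X)
  define B where "B = (\<lambda>b i K. A i (if b i then insert x K else K))"
  define M where "M = Pi_pmf I False (\<lambda>_. bernoulli_pmf p)"
  define R where "R = random_subset X p"
  define P1 where "P1 i = measure_pmf.prob R {S. A i (insert x S)}" for i
  define P0 where "P0 i = measure_pmf.prob R {S. A i S}" for i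
  have "measure_pmf.prob (random_subset (insert x X) p) {S. disjointly J A S} =
        p * measure_pmf.prob R {S. disjointly J A (insert x S)}
           + (1 - p) * measure_pmf.prob R {S. disjointly J A S}"
    unfolding R_def using insert.hyps assms by (intro prob_random_subset_insert) auto
  also have "\<dots> = measure_pmf.expectation R
       (\<lambda>S. p * of_bool (disjointly J A (insert x S)) + (1 - p) * of_bool (disjointly J A S))"
  proof -
    have e: "measure_pmf.expectation R (\<lambda>S. of_bool (Q S)) = measure_pmf.prob R {S. Q S}" for Q
    proof -
      have "(\<lambda>S. of_bool (Q S)) = (indicator {S. Q S} :: _ \<Rightarrow> real)" by (auto simp: indicator_def)
      then show ?thesis by simp
    qed
    have i: "integrable (measure_pmf R) (\<lambda>S. of_bool (Q S) :: real)" for Q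
      by (rule integrable_bounded_pmf[where B = 1]) auto
    show ?thesis by (simp add: e i)
  qed
  also have "\<dots> \<le> measure_pmf.expectation R (\<lambda>S. measure_pmf.prob M {b. disjointly J (B b) S})"
  proof (rule integral_mono_AE)
    show "AE S in measure_pmf R.
       p * of_bool (disjointly J A (insert x S)) + (1 - p) * of_bool (disjointly J A S)
       \<le> measure_pmf.prob M {b. disjointly J (B b) S}"
      unfolding AE_measure_pmf_iff M_def B_def
    proof
      fix S assume "S \<in> set_pmf R"
      then have "x \<notin> S" using insert(2) random_subset_subset unfolding R_def by blast
      then show "p * of_bool (disjointly J A (insert x S)) + (1 - p) * of_bool (disjointly J A S)
       \<le> measure_pmf.prob (Pi_pmf I False (\<lambda>_. bernoulli_pmf p))
           {b. disjointly J (\<lambda>i K. A i (if b i then insert x K else K)) S}"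
        using insert.prems assms by (intro disjointly_split) auto
    qed
    show "integrable (measure_pmf R) (\<lambda>S. p * of_bool (disjointly J A (insert x S))
            + (1 - p) * of_bool (disjointly J A S))"
      using assms by (intro integrable_bounded_pmf[where B = 1]) auto
  qed (auto intro!: integrable_bounded_pmf[where B = 1])
  also have "\<dots> = measure_pmf.prob (bind_pmf R (\<lambda>S. map_pmf (\<lambda>b. disjointly J (B b) S) M)) {True}"
    by (simp add: prob_bind_pmf vimage_def)
  \<comment> \<open>The copies are now drawn before the set, so for each fixed \<open>b\<close> the
    induction hypothesis applies to the events \<open>B b\<close>.\<close>
  also have "\<dots> = measure_pmf.prob (bind_pmf M (\<lambda>b. map_pmf (\<lambda>S. disjointly J (B b) S) R)) {True}"
    unfolding map_pmf_def by (subst bind_commute_pmf) simp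
  also have "\<dots> = measure_pmf.expectation M (\<lambda>b. measure_pmf.prob R {S. disjointly J (B b) S})"
    by (simp add: prob_bind_pmf vimage_def)
  also have "\<dots> \<le> measure_pmf.expectation M (\<lambda>b. measure_pmf.prob
        (Pi_pmf I False (\<lambda>i. bernoulli_pmf (measure_pmf.prob R {S. B b i S}))) (some_all J))"
  proof (rule integral_mono_AE)
    show "AE b in measure_pmf M. measure_pmf.prob R {S. disjointly J (B b) S} \<le> measure_pmf.prob
        (Pi_pmf I False (\<lambda>i. bernoulli_pmf (measure_pmf.prob R {S. B b i S}))) (some_all J)"
      unfolding R_def
    proof (intro AE_I2 insert.IH)
      fix b i K K' assume "i \<in> I" "B b i K" "K \<subseteq> K'"
      then show "B b i K'"
        using insert.prems[of i "if b i then insert x K else K" "if b i then insert x K' else K'"]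
        by (auto simp: B_def split: if_splits)
    qed
  qed (auto intro!: integrable_bounded_pmf[where B = 1])
  also have "\<dots> = measure_pmf.prob (bind_pmf M (\<lambda>b. Pi_pmf I False
        (\<lambda>i. bernoulli_pmf (measure_pmf.prob R {S. B b i S})))) (some_all J)"
    by (simp add: prob_bind_pmf)
  also have "bind_pmf M (\<lambda>b. Pi_pmf I False
        (\<lambda>i. bernoulli_pmf (measure_pmf.prob R {S. B b i S}))) =
     bind_pmf M (\<lambda>b. Pi_pmf I False (\<lambda>i. bernoulli_pmf (if b i then P1 i else P0 i)))"
    by (intro bind_pmf_cong Pi_pmf_cong) (auto simp: B_def P1_def P0_def assms)
  \<comment> \<open>Averaging over the copies leaves the indicators independent, and the new
    parameter is the probability of \<open>A i\<close> over the enlarged ground set.\<close>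
  also have "\<dots> = Pi_pmf I False (\<lambda>i. bernoulli_pmf (p * P1 i + (1 - p) * P0 i))"
    unfolding M_def using assms by (intro Pi_pmf_bernoulli_mixture) (auto simp: P1_def P0_def)
  also have "(\<lambda>i. p * P1 i + (1 - p) * P0 i) =
      (\<lambda>i. measure_pmf.prob (random_subset (insert x X) p) {S. A i S})"
    using insert.hyps assms by (simp add: P1_def P0_def R_def prob_random_subset_insert)
  finally show ?case by simp
qed


text \<open>Thinning: an indicator of parameter \<open>q i\<close> is one of parameter
  \<open>q' i\<close> kept with probability \<open>q i / q' i\<close>. This only turns indicators
  off, and \<open>some_all J\<close> is closed upwards.\<close>

lemma prob_some_all_mono:
  assumes "finite I" "J \<subseteq> Pow I" "\<And>i. i \<in> I \<Longrightarrow> 0 \<le> q i \<and> q i \<le> q' i \<and> q' i \<le> 1"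
  shows "measure_pmf.prob (Pi_pmf I False (\<lambda>i. bernoulli_pmf (q i))) (some_all J)
       \<le> measure_pmf.prob (Pi_pmf I False (\<lambda>i. bernoulli_pmf (q' i))) (some_all J)"
proof -
  \<comment> \<open>If \<open>q' i = 0\<close>, then \<open>q i = 0\<close> as well and the quotient
    is \<open>0\<close>, still a probability.\<close>
  define c where "c i t = bernoulli_pmf (if t then q i / q' i else 0)" for i t
  have zero: "bernoulli_pmf 0 = return_pmf False"
    by (rule pmf_eqI) (auto simp: indicator_def split: bool.split)
  have "bernoulli_pmf (q i) = bind_pmf (bernoulli_pmf (q' i)) (c i)" if "i \<in> I" for i
    unfolding c_def using assms(3)[OF that] by (subst bernoulli_mixture) (auto simp: divide_le_eq_1)
  then have "Pi_pmf I False (\<lambda>i. bernoulli_pmf (q i)) =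
      bind_pmf (Pi_pmf I False (\<lambda>i. bernoulli_pmf (q' i))) (\<lambda>t. Pi_pmf I False (\<lambda>i. c i (t i)))"
    using assms(1) by (subst Pi_pmf_bind[symmetric]) (auto intro!: Pi_pmf_cong)
  then have "measure_pmf.prob (Pi_pmf I False (\<lambda>i. bernoulli_pmf (q i))) (some_all J) =
     measure_pmf.expectation (Pi_pmf I False (\<lambda>i. bernoulli_pmf (q' i)))
       (\<lambda>t. measure_pmf.prob (Pi_pmf I False (\<lambda>i. c i (t i))) (some_all J))"
    by (simp add: prob_bind_pmf)
  also have "\<dots> \<le> measure_pmf.expectation (Pi_pmf I False (\<lambda>i. bernoulli_pmf (q' i)))
       (indicator (some_all J))"
  proof (rule integral_mono_AE)
    have "measure_pmf.prob (Pi_pmf I False (\<lambda>i. c i (t i))) (some_all J) \<le> indicator (some_all J) t" for t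
    proof (cases "t \<in> some_all J")
      case False
      have "f \<notin> some_all J" if "f \<in> set_pmf (Pi_pmf I False (\<lambda>i. c i (t i)))" for f
      proof
        assume "f \<in> some_all J"
        moreover have "t i" if "i \<in> I" "f i" for i
          using \<open>f \<in> set_pmf _\<close> that assms(1)
          by (auto simp: set_Pi_pmf PiE_dflt_def c_def zero split: if_splits)
        ultimately show False using False assms(2) unfolding some_all_def by blast
      qed
      then have "measure_pmf.prob (Pi_pmf I False (\<lambda>i. c i (t i))) (some_all J) = 0"
        by (subst measure_pmf_zero_iff) auto
      then show ?thesis by simp
    qed auto
    then show "AE t in measure_pmf (Pi_pmf I False (\<lambda>i. bernoulli_pmf (q' i))).
       measure_pmf.prob (Pi_pmf I False (\<lambda>i. c i (t i))) (some_all J) \<le> indicator (some_all J) t"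
      by simp
  qed (auto intro!: integrable_bounded_pmf[where B = 1] simp: indicator_def)
  finally show ?thesis by simp
qed

lemma prob_at_least_of_binomial:
  assumes "finite I" "0 \<le> q" "q \<le> 1"
  shows "measure_pmf.prob (Pi_pmf I False (\<lambda>i. bernoulli_pmf q)) (some_all {T. T \<subseteq> I \<and> card T = j})
       = measure_pmf.prob (binomial_pmf (card I) q) {j..}"
proof -
  have "f \<in> some_all {T. T \<subseteq> I \<and> card T = j} \<longleftrightarrow> j \<le> card {i\<in>I. f i}" for f
  proof
    assume "f \<in> some_all {T. T \<subseteq> I \<and> card T = j}"
    then obtain T where "T \<subseteq> {i\<in>I. f i}" "card T = j" by (auto simp: some_all_def)
    then show "j \<le> card {i\<in>I. f i}" using assms(1) card_mono[of "{i\<in>I. f i}" T] by auto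
  next
    assume "j \<le> card {i\<in>I. f i}"
    then obtain T where "T \<subseteq> {i\<in>I. f i}" "card T = j"
      by (metis obtain_subset_with_card_n)
    then show "f \<in> some_all {T. T \<subseteq> I \<and> card T = j}" by (auto simp: some_all_def)
  qed
  then have "(\<lambda>f. card {i\<in>I. f i}) -` {j..} = some_all {T. T \<subseteq> I \<and> card T = j}" by auto
  moreover have "binomial_pmf (card I) q =
      map_pmf (\<lambda>f. card {i\<in>I. f i}) (Pi_pmf I False (\<lambda>_. bernoulli_pmf q))"
    using assms by (intro binomial_pmf_altdef') auto
  ultimately show ?thesis by simp
qed

text \<open>With a common bound \<open>q\<close> the independent comparison is a binomial tail:
  \<open>j = 1\<close> serves for one successful continuation, \<open>j = 2\<close> for two disjoint
  ones.\<close>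

lemma prob_at_least_disjointly:
  assumes "finite X" "finite I" "0 \<le> p" "p \<le> 1" "q \<le> 1"
    and "\<And>i K K'. i \<in> I \<Longrightarrow> A i K \<Longrightarrow> K \<subseteq> K' \<Longrightarrow> A i K'"
    and q: "\<And>i. i \<in> I \<Longrightarrow> measure_pmf.prob (random_subset X p) {S. A i S} \<le> q" "0 \<le> q"
  shows "measure_pmf.prob (random_subset X p) {S. disjointly {T. T \<subseteq> I \<and> card T = j} A S}
       \<le> measure_pmf.prob (binomial_pmf (card I) q) {j..}"
proof -
  have "measure_pmf.prob (random_subset X p) {S. disjointly {T. T \<subseteq> I \<and> card T = j} A S} \<le>
         measure_pmf.prob (Pi_pmf I False
            (\<lambda>i. bernoulli_pmf (measure_pmf.prob (random_subset X p) {S. A i S})))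
            (some_all {T. T \<subseteq> I \<and> card T = j})"
    using assms by (intro disjointly_prob_le) auto
  also have "\<dots> \<le> measure_pmf.prob (Pi_pmf I False (\<lambda>i. bernoulli_pmf q))
            (some_all {T. T \<subseteq> I \<and> card T = j})"
    using assms by (intro prob_some_all_mono) auto
  finally show ?thesis using assms by (simp add: prob_at_least_of_binomial)
qed

lemma prob_binomial_ge_1:
  assumes "0 \<le> q" "q \<le> 1"
  shows "measure_pmf.prob (binomial_pmf m q) {1..} = 1 - (1 - q) ^ m"
proof -
  have "{1::nat..} = UNIV - {0}" by auto
  then have "measure_pmf.prob (binomial_pmf m q) {1..} = 1 - measure_pmf.prob (binomial_pmf m q) {0}"
    using measure_pmf.prob_compl[of "{0::nat}" "binomial_pmf m q"] by simp
  then show ?thesis using assms by (simp add: measure_pmf_single)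
qed

text \<open>The probability that a binomial variable with parameters \<open>m\<close> and
  \<open>q\<close> is at least 2. At \<open>m = r\<close> and \<open>q = rho_star r d\<close> it is
  the bracket in \<open>path_beta\<close>. For \<open>m = 0\<close> the truncated exponent has
  coefficient 0.\<close>

definition two_or_more :: "nat \<Rightarrow> real \<Rightarrow> real" where
  "two_or_more m q = 1 - (1 - q) ^ m - real m * q * (1 - q) ^ (m - 1)"

lemma prob_binomial_ge_2:
  assumes "0 \<le> q" "q \<le> 1"
  shows "measure_pmf.prob (binomial_pmf m q) {2..} = two_or_more m q"
proof -
  have "{2::nat..} = UNIV - {0, 1}" by auto
  then have "measure_pmf.prob (binomial_pmf m q) {2..} = 1 - measure_pmf.prob (binomial_pmf m q) {0, 1}"
    using measure_pmf.prob_compl[of "{0::nat, 1}" "binomial_pmf m q"] by simp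
  also have "measure_pmf.prob (binomial_pmf m q) {0, 1} = (1 - q) ^ m + real m * q * (1 - q) ^ (m - 1)"
    using assms by (subst measure_measure_pmf_finite) auto
  finally show ?thesis by (simp add: two_or_more_def)
qed

text \<open>A single occurrence is a disjoint occurrence with one witness. The sum bound
  \<open>card I * q\<close> would be too weak: the form obtained here has the branching recursion as
  its limit.\<close>

lemma prob_union_le:
  assumes "finite X" "finite I" "0 \<le> p" "p \<le> 1" "q \<le> 1"
    and "\<And>i K K'. i \<in> I \<Longrightarrow> A i K \<Longrightarrow> K \<subseteq> K' \<Longrightarrow> A i K'"
    and q: "\<And>i. i \<in> I \<Longrightarrow> measure_pmf.prob (random_subset X p) {S. A i S} \<le> q" "0 \<le> q"
  shows "measure_pmf.prob (random_subset X p) {S. \<exists>i\<in>I. A i S} \<le> 1 - (1 - q) ^ card I"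
proof -
  have "disjointly {T. T \<subseteq> I \<and> card T = 1} A S" if "i \<in> I" "A i S" for i S
    unfolding disjointly_def using that
    by (intro bexI[of _ "{i}"] exI[of _ "\<lambda>_. S"]) (auto simp: disjoint_family_on_def)
  then have "measure_pmf.prob (random_subset X p) {S. \<exists>i\<in>I. A i S} \<le>
      measure_pmf.prob (random_subset X p) {S. disjointly {T. T \<subseteq> I \<and> card T = 1} A S}"
    by (intro prob_mono) auto
  also have "\<dots> \<le> measure_pmf.prob (binomial_pmf (card I) q) {1..}"
    by (rule prob_at_least_disjointly) (fact assms)+
  finally show ?thesis using assms(5) q(2) prob_binomial_ge_1[of q "card I"] by simp
qed

lemma prob_two_disjointly_le:
  assumes "finite X" "finite I" "0 \<le> p" "p \<le> 1" "q \<le> 1"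
    and "\<And>i K K'. i \<in> I \<Longrightarrow> A i K \<Longrightarrow> K \<subseteq> K' \<Longrightarrow> A i K'"
    and q: "\<And>i. i \<in> I \<Longrightarrow> measure_pmf.prob (random_subset X p) {S. A i S} \<le> q" "0 \<le> q"
  shows "measure_pmf.prob (random_subset X p)
     {S. \<exists>i\<in>I. \<exists>j\<in>I. i \<noteq> j \<and> (\<exists>K L. K \<subseteq> S \<and> L \<subseteq> S \<and> K \<inter> L = {} \<and> A i K \<and> A j L)}
      \<le> two_or_more (card I) q"
proof -
  have *: "disjointly {T. T \<subseteq> I \<and> card T = 2} A S"
    if "i \<in> I" "j \<in> I" "i \<noteq> j" "K \<subseteq> S" "L \<subseteq> S" "K \<inter> L = {}" "A i K" "A j L" for i j K L S
    unfolding disjointly_def using that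
    by (intro bexI[of _ "{i, j}"] exI[of _ "\<lambda>t. if t = i then K else L"])
       (auto simp: disjoint_family_on_def)
  have "measure_pmf.prob (random_subset X p)
     {S. \<exists>i\<in>I. \<exists>j\<in>I. i \<noteq> j \<and> (\<exists>K L. K \<subseteq> S \<and> L \<subseteq> S \<and> K \<inter> L = {} \<and> A i K \<and> A j L)} \<le>
      measure_pmf.prob (random_subset X p) {S. disjointly {T. T \<subseteq> I \<and> card T = 2} A S}"
    by (intro prob_mono, elim bexE exE conjE) (rule *)
  also have "\<dots> \<le> measure_pmf.prob (binomial_pmf (card I) q) {2..}"
    by (rule prob_at_least_disjointly) (fact assms)+
  finally show ?thesis using assms(5) q(2) by (simp add: prob_binomial_ge_2)
qed

text \<open>The two-event form: the index set is \<open>bool\<close>, and \<open>UNIV\<close> is the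
  only admissible set of indices.\<close>

theorem van_den_Berg_Kesten:
  assumes "finite X" "0 \<le> p" "p \<le> 1"
    and "\<And>K K'. A K \<Longrightarrow> K \<subseteq> K' \<Longrightarrow> A K'" "\<And>K K'. B K \<Longrightarrow> K \<subseteq> K' \<Longrightarrow> B K'"
  shows "measure_pmf.prob (random_subset X p) {S. \<exists>K L. K \<subseteq> S \<and> L \<subseteq> S \<and> K \<inter> L = {} \<and> A K \<and> B L}
     \<le> measure_pmf.prob (random_subset X p) {S. A S} * measure_pmf.prob (random_subset X p) {S. B S}"
proof -
  let ?R = "random_subset X p"
  define C where "C b = (if b then A else B)" for b
  have *: "disjointly {UNIV} C S" if "K \<subseteq> S" "L \<subseteq> S" "K \<inter> L = {}" "A K" "B L" for K L S
    unfolding disjointly_def using that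
    by (intro bexI[of _ UNIV] exI[of _ "\<lambda>t. if t then K else L"])
       (auto simp: disjoint_family_on_def C_def)
  have "measure_pmf.prob ?R {S. \<exists>K L. K \<subseteq> S \<and> L \<subseteq> S \<and> K \<inter> L = {} \<and> A K \<and> B L}
      \<le> measure_pmf.prob ?R {S. disjointly {UNIV} C S}"
    by (intro prob_mono, elim exE conjE) (rule *)
  also have "\<dots> \<le> measure_pmf.prob (Pi_pmf UNIV False
            (\<lambda>b. bernoulli_pmf (measure_pmf.prob ?R {S. C b S}))) (some_all {UNIV})"
    using assms by (intro disjointly_prob_le) (auto simp: C_def)
  also have "some_all {UNIV} = Pi UNIV (\<lambda>_::bool. {True})"
    by (auto simp: some_all_def)
  also have "measure_pmf.prob (Pi_pmf UNIV False
            (\<lambda>b. bernoulli_pmf (measure_pmf.prob ?R {S. C b S}))) \<dots>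
       = measure_pmf.prob ?R {S. A S} * measure_pmf.prob ?R {S. B S}"
    by (subst measure_Pi_pmf_Pi) (auto simp: measure_pmf_single UNIV_bool C_def)
  finally show ?thesis .
qed

section \<open>Branches in a hypergraph\<close>

text \<open>Deleting \<open>e\<close> makes the continuation independent of the presence of
  \<open>e\<close>; leaving through a vertex other than \<open>v\<close> gives the
  \<open>r - 1\<close> exits of the branching process.\<close>

fun reach :: "nat \<Rightarrow> 'a \<Rightarrow> 'a set set \<Rightarrow> bool" where
  "reach 0 v K \<longleftrightarrow> True"
| "reach (Suc k) v K \<longleftrightarrow> (\<exists>e\<in>K. v \<in> e \<and> (\<exists>w\<in>e - {v}. reach k w (K - {e})))"

text \<open>The contribution of one fixed edge to \<open>reach (Suc k) v\<close>, isolated because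
  disjoint occurrence is applied to the family of all edges at \<open>v\<close>.\<close>

definition branch :: "nat \<Rightarrow> 'a \<Rightarrow> 'a set \<Rightarrow> 'a set set \<Rightarrow> bool" where
  "branch k v e K \<longleftrightarrow> e \<in> K \<and> v \<in> e \<and> (\<exists>w\<in>e - {v}. reach k w (K - {e}))"

definition vertex_event :: "nat \<Rightarrow> 'a \<Rightarrow> 'a set set \<Rightarrow> bool" where
  "vertex_event k v K \<longleftrightarrow> (\<exists>e\<in>K. \<exists>f\<in>K. e \<noteq> f \<and>
     (\<exists>K1 K2. K1 \<subseteq> K \<and> K2 \<subseteq> K \<and> K1 \<inter> K2 = {} \<and> branch k v e K1 \<and> branch k v f K2))"

definition edge_event :: "nat \<Rightarrow> 'a set \<Rightarrow> 'a set set \<Rightarrow> bool" where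
  "edge_event k e K \<longleftrightarrow> e \<in> K \<and> (\<exists>v\<in>e. \<exists>w\<in>e. v \<noteq> w \<and>
     (\<exists>K1 K2. K1 \<subseteq> K - {e} \<and> K2 \<subseteq> K - {e} \<and> K1 \<inter> K2 = {} \<and> reach k v K1 \<and> reach k w K2))"

lemma reach_Suc_iff_branch: "reach (Suc k) v K \<longleftrightarrow> (\<exists>e\<in>K. branch k v e K)"
  by (auto simp: branch_def)

lemma reach_mono: "reach k v K \<Longrightarrow> K \<subseteq> K' \<Longrightarrow> reach k v K'"
proof (induction k arbitrary: v K K')
  case (Suc k)
  then obtain e w where "e \<in> K" "v \<in> e" "w \<in> e - {v}" "reach k w (K - {e})" by auto
  moreover from this have "reach k w (K' - {e})" using Suc by (meson Diff_mono order_refl)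
  ultimately show ?case using Suc.prems(2) by auto
qed simp

lemma branch_mono: "branch k v e K \<Longrightarrow> K \<subseteq> K' \<Longrightarrow> branch k v e K'"
  unfolding branch_def by (meson Diff_mono order_refl reach_mono subsetD)

lemma vertex_event_mono: "vertex_event k v K \<Longrightarrow> K \<subseteq> K' \<Longrightarrow> vertex_event k v K'"
  unfolding vertex_event_def by (meson subsetD subset_trans)

lemma edge_event_mono: "edge_event k e K \<Longrightarrow> K \<subseteq> K' \<Longrightarrow> edge_event k e K'"
  unfolding edge_event_def by (meson Diff_mono order_refl subsetD subset_trans)

section \<open>Locality of the events and connections between neighbourhoods\<close>

definition adj :: "'a set set \<Rightarrow> ('a \<times> 'a) set" where
  "adj K = {(v, w). \<exists>e\<in>K. v \<in> e \<and> w \<in> e}"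

definition near :: "nat \<Rightarrow> 'a \<Rightarrow> 'a set set \<Rightarrow> 'a set set" where
  "near L v K = {f\<in>K. \<exists>w\<in>f. \<exists>j\<le>L. (v, w) \<in> adj K ^^ j}"

lemma walk_mono: "K \<subseteq> K' \<Longrightarrow> (v, u) \<in> adj K ^^ m \<Longrightarrow> (v, u) \<in> adj K' ^^ m"
  by (induction m arbitrary: u) (auto simp: adj_def)

lemma walk_sym: "(v, u) \<in> adj K ^^ m \<Longrightarrow> (u, v) \<in> adj K ^^ m"
proof (induction m arbitrary: u)
  case (Suc m)
  then obtain w where "(v, w) \<in> adj K ^^ m" "(w, u) \<in> adj K" by auto
  then have "(w, v) \<in> adj K ^^ m" "(u, w) \<in> adj K" using Suc.IH by (auto simp: adj_def)
  then show ?case by (rule relpow_Suc_I2[rotated])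
qed simp

lemma near_mono: "K \<subseteq> K' \<Longrightarrow> near L v K \<subseteq> near L v K'"
  unfolding near_def using walk_mono[of K K'] by blast

lemma near_step:
  assumes "f \<in> near L w K'" "K' \<subseteq> K" "e \<in> K" "v \<in> e" "w \<in> e"
  shows "f \<in> near (Suc L) v K"
proof -
  obtain x j where x: "f \<in> K'" "x \<in> f" "j \<le> L" "(w, x) \<in> adj K' ^^ j"
    using assms(1) by (auto simp: near_def)
  then have "(w, x) \<in> adj K ^^ j" using walk_mono[OF assms(2)] by blast
  moreover have "(v, w) \<in> adj K" using assms by (auto simp: adj_def)
  ultimately have "(v, x) \<in> adj K ^^ Suc j" by (rule relpow_Suc_I2[rotated])
  then show ?thesis using x assms(2) unfolding near_def by (blast intro: Suc_le_mono[THEN iffD2])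
qed

lemma near_incident: "e \<in> K \<Longrightarrow> v \<in> e \<Longrightarrow> e \<in> near L v K"
  unfolding near_def by (auto intro!: bexI[of _ v] exI[of _ 0])

text \<open>The step shared by \<open>reach_near\<close> and \<open>branch_near\<close>, with the
  induction hypothesis of the former as first assumption. The continuation starts one step away from
  \<open>v\<close>, so the radius grows by one.\<close>

lemma branch_near_if_reach_near:
  assumes "\<And>w. w \<in> e \<Longrightarrow> reach k w (K - {e}) \<Longrightarrow> reach k w (near k w (K - {e}))" "branch k v e K"
  shows "branch k v e (near (Suc k) v K)"
proof -
  obtain w where w: "e \<in> K" "v \<in> e" "w \<in> e - {v}" "reach k w (K - {e})"
    using assms(2) by (auto simp: branch_def)
  have "near k w (K - {e}) \<subseteq> near (Suc k) v K - {e}"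
  proof
    fix f assume f: "f \<in> near k w (K - {e})"
    then have "f \<in> near (Suc k) v K" using w by (intro near_step[OF f, of K e]) auto
    then show "f \<in> near (Suc k) v K - {e}" using f by (auto simp: near_def)
  qed
  then have "reach k w (near (Suc k) v K - {e})"
    using assms(1) w reach_mono by (metis DiffD1)
  then show ?thesis using w near_incident[of e K v] by (auto simp: branch_def)
qed

lemma reach_near: "reach k v K \<Longrightarrow> reach k v (near k v K)"
proof (induction k arbitrary: v K)
  case (Suc k)
  then obtain e where "branch k v e K" unfolding reach_Suc_iff_branch by blast
  then have "branch k v e (near (Suc k) v K)" using Suc.IH by (intro branch_near_if_reach_near)
  then show ?case unfolding reach_Suc_iff_branch by (auto simp: branch_def)
qed simp

lemma branch_near: "branch k v e K \<Longrightarrow> branch k v e (near (Suc k) v K)"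
  by (intro branch_near_if_reach_near reach_near)

lemma vertex_event_near:
  assumes "vertex_event k v K"
  shows "vertex_event k v (near (Suc k) v K)"
proof -
  obtain e f K1 K2 where *: "e \<noteq> f" "K1 \<subseteq> K" "K2 \<subseteq> K" "K1 \<inter> K2 = {}"
      "branch k v e K1" "branch k v f K2"
    using assms unfolding vertex_event_def by blast
  let ?N = "near (Suc k) v"
  have "branch k v e (?N K1)" "branch k v f (?N K2)" using * by (auto intro: branch_near)
  moreover from this have "e \<in> ?N K1" "f \<in> ?N K2" by (auto simp: branch_def)
  moreover have "?N K1 \<subseteq> ?N K" "?N K2 \<subseteq> ?N K" using * by (auto intro!: near_mono)
  moreover have "?N K1 \<inter> ?N K2 = {}" using * by (auto simp: near_def)
  ultimately show ?thesis using \<open>e \<noteq> f\<close> unfolding vertex_event_def by blast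
qed

text \<open>Any vertex \<open>u\<close> of \<open>e\<close> can serve as centre: both exits are one
  step away from it, across \<open>e\<close>. The neighbourhood is therefore taken in
  \<open>K\<close>, although the witnesses avoid \<open>e\<close>.\<close>

lemma edge_event_near:
  assumes "edge_event k e K" "u \<in> e"
  shows "edge_event k e (near (Suc k) u K)"
proof -
  obtain v w K1 K2 where *: "e \<in> K" "v \<in> e" "w \<in> e" "v \<noteq> w" "K1 \<subseteq> K - {e}" "K2 \<subseteq> K - {e}"
      "K1 \<inter> K2 = {}" "reach k v K1" "reach k w K2"
    using assms(1) unfolding edge_event_def by blast
  have N: "near k x K' \<subseteq> near (Suc k) u K - {e}" if "x \<in> e" "K' \<subseteq> K - {e}" for x K'
  proof
    fix f assume f: "f \<in> near k x K'"
    have "K' \<subseteq> K" using that(2) by blast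
    then have "f \<in> near (Suc k) u K" using near_step[OF f _ *(1) assms(2) that(1)] by blast
    moreover have "f \<noteq> e" using f that(2) by (auto simp: near_def)
    ultimately show "f \<in> near (Suc k) u K - {e}" by simp
  qed
  have disj: "near k v K1 \<inter> near k w K2 = {}" using *(7) by (auto simp: near_def)
  have sub: "near k v K1 \<subseteq> near (Suc k) u K - {e}" "near k w K2 \<subseteq> near (Suc k) u K - {e}"
    by (rule N[OF *(2,5)], rule N[OF *(3,6)])
  have "\<exists>L1 L2. L1 \<subseteq> near (Suc k) u K - {e} \<and> L2 \<subseteq> near (Suc k) u K - {e} \<and> L1 \<inter> L2 = {}
      \<and> reach k v L1 \<and> reach k w L2"
    by (intro exI conjI) (fact sub disj reach_near[OF *(8)] reach_near[OF *(9)])+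
  then show ?thesis
    unfolding edge_event_def using *(2,3,4) near_incident[OF *(1) assms(2)] by blast
qed

text \<open>A walk in \<open>adj\<close> may reuse an edge at no probabilistic cost. Here every step
  consumes its edge, so every step contributes its own factor \<open>p\<close>.\<close>

fun conn :: "nat \<Rightarrow> 'a \<Rightarrow> 'a \<Rightarrow> 'a set set \<Rightarrow> bool" where
  "conn 0 v u K \<longleftrightarrow> v = u"
| "conn (Suc m) v u K \<longleftrightarrow> (\<exists>e\<in>K. v \<in> e \<and> (\<exists>w\<in>e. conn m w u (K - {e})))"

lemma conn_mono: "conn m v u K \<Longrightarrow> K \<subseteq> K' \<Longrightarrow> conn m v u K'"
proof (induction m arbitrary: v K K')
  case (Suc m)
  then obtain e w where "e \<in> K" "v \<in> e" "w \<in> e" "conn m w u (K - {e})" by auto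
  moreover from this have "conn m w u (K' - {e})" using Suc by (meson Diff_mono order_refl)
  ultimately show ?case using Suc.prems(2) by auto
qed simp

lemma conn_imp_walk: "conn m v u K \<Longrightarrow> (v, u) \<in> adj K ^^ m"
proof (induction m arbitrary: v K)
  case (Suc m)
  then obtain e w where e: "e \<in> K" "v \<in> e" "w \<in> e" "conn m w u (K - {e})" by auto
  have "(w, u) \<in> adj K ^^ m"
    using walk_mono[OF _ Suc.IH[OF e(4)], of K] by blast
  moreover have "(v, w) \<in> adj K" using e by (auto simp: adj_def)
  ultimately show ?case by (rule relpow_Suc_I2[rotated])
qed simp

text \<open>Cut at the use of \<open>e\<close>: what follows starts in \<open>e\<close> and is
  strictly shorter. One cut suffices because an edge is used at most once.\<close>

lemma conn_delete_edge:
  assumes "conn m w u K"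
  shows "conn m w u (K - {e}) \<or> (\<exists>m'<m. \<exists>w'\<in>e. conn m' w' u (K - {e}))"
  using assms
proof (induction m arbitrary: w K)
  case (Suc m)
  then obtain f x where f: "f \<in> K" "w \<in> f" "x \<in> f" "conn m x u (K - {f})" by auto
  show ?case
  proof (cases "f = e")
    case True
    then show ?thesis using f by (intro disjI2 exI[of _ m]) auto
  next
    case False
    have "K - {f} - {e} = K - {e} - {f}" by auto
    with Suc.IH[OF f(4)] consider "conn m x u (K - {e} - {f})"
      | m' w' where "m' < m" "w' \<in> e" "conn m' w' u (K - {e} - {f})" by auto
    then show ?thesis
    proof cases
      case 1
      then have "conn (Suc m) w u (K - {e})" using f False by auto
      then show ?thesis by simp
    next
      case 2
      moreover from 2(3) have "conn m' w' u (K - {e})" by (rule conn_mono) auto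
      ultimately show ?thesis by (meson less_Suc_eq)
    qed
  qed
qed simp

text \<open>Loop erasure for edges: make the walk after the first edge repetition-free by induction;
  if it uses that edge again, restart from the vertex at which it leaves it.\<close>

lemma walk_imp_conn: "(v, u) \<in> adj K ^^ m \<Longrightarrow> \<exists>m'\<le>m. conn m' v u K"
proof (induction m arbitrary: v)
  case (Suc m)
  then obtain w where w: "(v, w) \<in> adj K" "(w, u) \<in> adj K ^^ m" by (meson relpow_Suc_D2)
  then obtain e where e: "e \<in> K" "v \<in> e" "w \<in> e" by (auto simp: adj_def)
  obtain m1 where "m1 \<le> m" "conn m1 w u K" using Suc.IH w by blast
  then obtain m2 x where "m2 \<le> m1" "x \<in> e" "conn m2 x u (K - {e})"
    using conn_delete_edge[of m1 w u K e] e(3) less_imp_le by blast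
  then have "conn (Suc m2) v u K" "Suc m2 \<le> Suc m" using e \<open>m1 \<le> m\<close> by auto
  then show ?case by blast
qed simp

text \<open>At most \<open>L\<close> steps from either centre and one step across the common edge
  \<open>f\<close> give \<open>2 * L + 1\<close>.\<close>

lemma near_meet_imp_conn:
  assumes "f \<in> near L u K" "f \<in> near L v K"
  shows "\<exists>m\<le>2 * L + 1. conn m u v K"
proof -
  obtain x i where x: "f \<in> K" "x \<in> f" "i \<le> L" "(u, x) \<in> adj K ^^ i"
    using assms(1) unfolding near_def by blast
  obtain y j where y: "y \<in> f" "j \<le> L" "(v, y) \<in> adj K ^^ j"
    using assms(2) unfolding near_def by blast
  have yv: "(y, v) \<in> adj K ^^ j" using y(3) by (rule walk_sym)
  have xy: "(x, y) \<in> adj K ^^ 1" using x(1,2) y(1) by (auto simp: adj_def)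
  have "(u, v) \<in> adj K ^^ (i + (1 + j))"
    unfolding relpow_add by (rule relcompI[OF x(4) relcompI[OF xy yv]])
  from walk_imp_conn[OF this] obtain m where m: "m \<le> i + (1 + j)" "conn m u v K"
    by (elim exE conjE)
  then have "m \<le> 2 * L + 1" using x(3) y(2) by linarith
  then show ?thesis using m(2) by (intro exI[of _ m] conjI)
qed

section \<open>Branches along a loose path\<close>

context
  fixes r :: nat and V :: "'a set" and E :: "'a set set" and l :: nat
    and v :: "nat \<Rightarrow> 'a" and e :: "nat \<Rightarrow> 'a set"
  assumes r: "r \<ge> 2" and path: "loose_path r V E l v e"
begin

text \<open>The vertex shared by the edges \<open>i\<close> and \<open>i + 1\<close>;
  \<open>joint 0\<close> and \<open>joint l\<close> are the ends of the path.\<close>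

definition joint :: "nat \<Rightarrow> 'a" where "joint i = v (i * (r - 1) + 1)"

lemma joint_eq_iff: "i \<le> l \<Longrightarrow> j \<le> l \<Longrightarrow> joint i = joint j \<longleftrightarrow> i = j"
  using path r unfolding joint_def loose_path_def
  by (subst inj_on_eq_iff[where f = v and A = "{1..l * (r - 1) + 1}"]) auto

lemma joint_in_V: "i \<le> l \<Longrightarrow> joint i \<in> V"
  using path unfolding joint_def loose_path_def by (auto simp: image_subset_iff)

lemma edge_eq: "1 \<le> i \<Longrightarrow> i \<le> l \<Longrightarrow> e i = v ` {(i - 1) * (r - 1) + 1..(i - 1) * (r - 1) + r}"
  using path unfolding loose_path_def by auto

lemma edge_in: "1 \<le> i \<Longrightarrow> i \<le> l \<Longrightarrow> e i \<in> E"
  using path unfolding loose_path_def by (meson atLeastAtMost_iff)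

lemma joint_in_left: "1 \<le> i \<Longrightarrow> i \<le> l \<Longrightarrow> joint (i - 1) \<in> e i"
  unfolding edge_eq joint_def using r by (intro imageI) auto

lemma joint_in_right: "1 \<le> i \<Longrightarrow> i \<le> l \<Longrightarrow> joint i \<in> e i"
  unfolding edge_eq joint_def using r by (intro imageI) (cases i; auto)

lemma joint_in_edge_iff:
  assumes "j \<le> l" "1 \<le> i" "i \<le> l"
  shows "joint j \<in> e i \<longleftrightarrow> j = i \<or> j = i - 1"
proof
  assume "joint j \<in> e i"
  then obtain t where t: "joint j = v t" "t \<in> {(i - 1) * (r - 1) + 1..(i - 1) * (r - 1) + r}"
    using assms edge_eq by auto
  have i: "(i - 1) * (r - 1) + r = i * (r - 1) + 1" using assms r by (cases i) auto
  have "i * (r - 1) \<le> l * (r - 1)" using assms by simp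
  then have "t \<in> {1..l * (r - 1) + 1}" using t(2) unfolding i atLeastAtMost_iff by linarith
  then have "j * (r - 1) + 1 = t"
    using t(1) path assms unfolding joint_def loose_path_def by (auto dest: inj_onD)
  then have "(i - 1) * (r - 1) \<le> j * (r - 1)" "j * (r - 1) \<le> i * (r - 1)" using t(2) unfolding i by auto
  then have "i - 1 \<le> j" "j \<le> i" using r by auto
  then show "j = i \<or> j = i - 1" by linarith
next
  assume "j = i \<or> j = i - 1"
  then show "joint j \<in> e i" using joint_in_left joint_in_right assms by auto
qed

text \<open>The only joints in \<open>e i\<close> are \<open>joint (i - 1)\<close> and
  \<open>joint i\<close>. Equal edges with distinct indices would contain each other's right joint,
  giving both \<open>i = j - 1\<close> and \<open>j = i - 1\<close>.\<close>

lemma edge_inj: "inj_on e {1..l}"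
proof (rule inj_onI)
  fix i j assume ij: "i \<in> {1..l}" "j \<in> {1..l}" "e i = e j"
  then have "joint i \<in> e j" "joint j \<in> e i" using joint_in_right by auto
  then have "i = j \<or> i = j - 1" "j = i \<or> j = i - 1"
    using joint_in_edge_iff[of i j] joint_in_edge_iff[of j i] ij by auto
  then show "i = j" using ij(1,2) unfolding atLeastAtMost_iff by arith
qed

lemma edges_delete:
  assumes "A \<subseteq> B - {i}" "B \<subseteq> {1..l}" "i \<in> {1..l}"
  shows "e ` A \<subseteq> e ` B - {e i}"
proof -
  have "e i \<notin> e ` A" using assms by (subst inj_on_image_mem_iff[OF edge_inj]) auto
  then show ?thesis using assms(1) by auto
qed

lemma edges_disjoint:
  assumes "A \<inter> B = {}" "A \<subseteq> {1..l}" "B \<subseteq> {1..l}"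
  shows "e ` A \<inter> e ` B = {}"
  using inj_on_image_Int[OF edge_inj assms(2,3)] assms(1) by simp

lemma edges_subset: "A \<subseteq> {1..l} \<Longrightarrow> e ` A \<subseteq> E"
  using edge_in by auto

lemma reach_up: "i + k \<le> l \<Longrightarrow> reach k (joint i) (e ` {i + 1..l})"
proof (induction k arbitrary: i)
  case (Suc k)
  have "reach k (joint (Suc i)) (e ` {Suc i + 1..l})" using Suc by simp
  moreover have "e ` {Suc i + 1..l} \<subseteq> e ` {i + 1..l} - {e (Suc i)}"
    using Suc.prems by (intro edges_delete) auto
  ultimately have "reach k (joint (Suc i)) (e ` {i + 1..l} - {e (Suc i)})" by (rule reach_mono)
  moreover have "joint i \<in> e (Suc i)" "joint (Suc i) \<in> e (Suc i)" "joint i \<noteq> joint (Suc i)"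
    using Suc.prems joint_in_left[of "Suc i"] joint_in_right[of "Suc i"] joint_eq_iff by auto
  ultimately show ?case using Suc.prems by (auto intro!: bexI[of _ "e (Suc i)"] bexI[of _ "joint (Suc i)"])
qed simp

lemma reach_down: "k \<le> i \<Longrightarrow> i \<le> l \<Longrightarrow> reach k (joint i) (e ` {1..i})"
proof (induction k arbitrary: i)
  case (Suc k)
  have "reach k (joint (i - 1)) (e ` {1..i - 1})" using Suc by simp
  moreover have "e ` {1..i - 1} \<subseteq> e ` {1..i} - {e i}"
    using Suc.prems by (intro edges_delete) auto
  ultimately have "reach k (joint (i - 1)) (e ` {1..i} - {e i})" by (rule reach_mono)
  moreover have "joint (i - 1) \<in> e i" "joint i \<in> e i" "joint i \<noteq> joint (i - 1)"
    using Suc.prems joint_in_left[of i] joint_in_right[of i] joint_eq_iff by auto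
  ultimately show ?case using Suc.prems by (auto intro!: bexI[of _ "e i"] bexI[of _ "joint (i - 1)"])
qed simp

text \<open>The exits are the joints at both ends of \<open>e i\<close>. There are
  \<open>i - 1\<close> edges before it and \<open>l - i\<close> after it, and either side must
  supply \<open>k\<close>.\<close>

lemma edge_event_path:
  assumes "k < i" "i + k \<le> l"
  shows "edge_event k (e i) E"
proof -
  let ?K1 = "e ` {1..i - 1}" and ?K2 = "e ` {i + 1..l}"
  have i: "1 \<le> i" "i \<le> l" using assms by auto
  have "?K1 \<subseteq> e ` {1..l} - {e i}" "?K2 \<subseteq> e ` {1..l} - {e i}"
    by (rule edges_delete; use i in force)+
  then have sub: "?K1 \<subseteq> E - {e i}" "?K2 \<subseteq> E - {e i}"
    using edges_subset[OF order.refl] by blast+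
  have disj: "?K1 \<inter> ?K2 = {}"
    by (rule edges_disjoint; use i in force)
  have reach: "reach k (joint (i - 1)) ?K1" "reach k (joint i) ?K2"
    using reach_down[of k "i - 1"] reach_up[of i k] assms by auto
  have "\<exists>K1 K2. K1 \<subseteq> E - {e i} \<and> K2 \<subseteq> E - {e i} \<and> K1 \<inter> K2 = {} \<and>
      reach k (joint (i - 1)) K1 \<and> reach k (joint i) K2"
    by (intro exI conjI) (fact sub disj reach)+
  moreover have "joint (i - 1) \<noteq> joint i" using i joint_eq_iff[of "i - 1" i] by auto
  ultimately show ?thesis
    unfolding edge_event_def using joint_in_left[OF i] joint_in_right[OF i] edge_in[OF i] by blast
qed

text \<open>A branch consists of its own edge and \<open>k\<close> more, so \<open>k + 1\<close>
  edges are required on either side of \<open>joint i\<close>, where \<open>i\<close> and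
  \<open>l - i\<close> are available.\<close>

lemma vertex_event_path:
  assumes "k < i" "i + k < l"
  shows "vertex_event k (joint i) E"
proof -
  let ?K1 = "e ` {1..i}" and ?K2 = "e ` {i + 1..l}"
  have i: "1 \<le> i" "i \<le> l" "1 \<le> Suc i" "Suc i \<le> l" using assms by auto
  have sub: "?K1 \<subseteq> E" "?K2 \<subseteq> E"
    by (rule edges_subset; use i in force)+
  have disj: "?K1 \<inter> ?K2 = {}"
    by (rule edges_disjoint; use i in force)
  have down: "e ` {1..i - 1} \<subseteq> ?K1 - {e i}"
    by (rule edges_delete; use i in force)
  have "reach k (joint (i - 1)) (?K1 - {e i})"
    by (rule reach_mono[OF reach_down down]; use assms in linarith)
  moreover have "joint (i - 1) \<noteq> joint i" using i joint_eq_iff[of "i - 1" i] by auto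
  moreover have "e i \<in> ?K1" using i by simp
  ultimately have b1: "branch k (joint i) (e i) ?K1"
    unfolding branch_def using joint_in_left[OF i(1,2)] joint_in_right[OF i(1,2)] by blast
  have up: "e ` {Suc i + 1..l} \<subseteq> ?K2 - {e (Suc i)}"
    by (rule edges_delete; use i in force)
  have "reach k (joint (Suc i)) (?K2 - {e (Suc i)})"
    by (rule reach_mono[OF reach_up up]; use assms in linarith)
  moreover have "joint (Suc i) \<noteq> joint i" using i joint_eq_iff[of "Suc i" i] by auto
  moreover have "e (Suc i) \<in> ?K2" using i by simp
  moreover have "joint i \<in> e (Suc i)" using joint_in_left[OF i(3,4)] by simp
  ultimately have b2: "branch k (joint i) (e (Suc i)) ?K2"
    unfolding branch_def using joint_in_right[OF i(3,4)] by blast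
  have "\<exists>K1 K2. K1 \<subseteq> E \<and> K2 \<subseteq> E \<and> K1 \<inter> K2 = {} \<and>
      branch k (joint i) (e i) K1 \<and> branch k (joint i) (e (Suc i)) K2"
    by (intro exI conjI) (fact sub disj b1 b2)+
  moreover have "e i \<noteq> e (Suc i)" using inj_onD[OF edge_inj, of i "Suc i"] i by auto
  ultimately show ?thesis
    unfolding vertex_event_def using edge_in[OF i(1,2)] edge_in[OF i(3,4)] by blast
qed

lemma path_length_le_edge_events:
  assumes "finite E"
  shows "l \<le> card {f\<in>E. edge_event k f E} + 2 * k"
proof -
  have "card (e ` {k + 1..l - k}) \<le> card {f\<in>E. edge_event k f E}"
    using assms edge_event_path edge_in by (intro card_mono) auto
  moreover have "card (e ` {k + 1..l - k}) = card {k + 1..l - k}"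
    by (intro card_image inj_on_subset[OF edge_inj]) auto
  ultimately show ?thesis by simp
qed

lemma path_length_le_vertex_events:
  assumes "finite V"
  shows "l \<le> card {x\<in>V. vertex_event k x E} + 2 * k + 1"
proof -
  have "card (joint ` {k + 1..<l - k}) \<le> card {x\<in>V. vertex_event k x E}"
    using assms vertex_event_path joint_in_V by (intro card_mono) auto
  moreover have "card (joint ` {k + 1..<l - k}) = card {k + 1..<l - k}"
    by (intro card_image inj_onI) (auto simp: joint_eq_iff)
  ultimately show ?thesis by simp
qed

end

section \<open>Concentration of sums of local increasing events\<close>

text \<open>Prepares the covariance of two edge events: the connection must survive the removal of
  both edges, so that the presence of each can be charged a separate \<open>p\<close>.\<close>

lemma conn_delete_two_edges:
  assumes "conn m a b K" "a \<in> e" "b \<in> f"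
  shows "\<exists>m'\<le>m. \<exists>w\<in>e. \<exists>u\<in>f. conn m' u w (K - {e} - {f})"
proof -
  obtain m1 w where 1: "m1 \<le> m" "w \<in> e" "conn m1 w b (K - {e})"
    using conn_delete_edge[OF assms(1), of e] assms(2) less_imp_le by blast
  \<comment> \<open>\<open>conn_delete_edge\<close> cuts at the start of a connection. To cut at the
    other end it is reversed, by way of symmetric walks.\<close>
  have "(b, w) \<in> adj (K - {e}) ^^ m1" using walk_sym[OF conn_imp_walk[OF 1(3)]] .
  from walk_imp_conn[OF this] obtain m2 where 2: "m2 \<le> m1" "conn m2 b w (K - {e})" by blast
  obtain m3 u where 3: "m3 \<le> m2" "u \<in> f" "conn m3 u w (K - {e} - {f})"
    using conn_delete_edge[OF 2(2), of f] assms(3) less_imp_le by blast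
  have "m3 \<le> m" using 1 2 3 by linarith
  then show ?thesis using 1(2) 3(2,3) by blast
qed

text \<open>Disjoint neighbourhoods are disjoint witnesses. The error term keeps \<open>A S\<close>
  and \<open>B S\<close> beside the connection, since for edge events they supply the two factors
  \<open>p\<close>.\<close>

lemma prob_local_events_le:
  assumes "finite X" "0 \<le> p" "p \<le> 1"
    and mono: "\<And>K K'. A K \<Longrightarrow> K \<subseteq> K' \<Longrightarrow> A K'" "\<And>K K'. B K \<Longrightarrow> K \<subseteq> K' \<Longrightarrow> B K'"
    and A: "\<And>K. A K \<Longrightarrow> A (near L a K)" and B: "\<And>K. B K \<Longrightarrow> B (near L b K)"
  defines "R \<equiv> random_subset X p"
  shows "measure_pmf.prob R {S. A S \<and> B S} \<le> measure_pmf.prob R {S. A S} * measure_pmf.prob R {S. B S}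
     + measure_pmf.prob R {S. A S \<and> B S \<and> (\<exists>m\<le>2 * L + 1. conn m a b S)}"
proof -
  let ?D = "\<lambda>S. \<exists>K1 K2. K1 \<subseteq> S \<and> K2 \<subseteq> S \<and> K1 \<inter> K2 = {} \<and> A K1 \<and> B K2"
  let ?C = "\<lambda>S. A S \<and> B S \<and> (\<exists>m\<le>2 * L + 1. conn m a b S)"
  have "?D S \<or> ?C S" if "A S" "B S" for S
  proof (cases "near L a S \<inter> near L b S = {}")
    case True
    have "near L a S \<subseteq> S" "near L b S \<subseteq> S" by (auto simp: near_def)
    then have "?D S"
      using True A[OF that(1)] B[OF that(2)] by (intro exI conjI)
    then show ?thesis ..
  next
    case False
    then obtain f where "f \<in> near L a S" "f \<in> near L b S" by blast
    then show ?thesis using near_meet_imp_conn that by (intro disjI2 conjI)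
  qed
  then have "measure_pmf.prob R {S. A S \<and> B S} \<le> measure_pmf.prob R ({S. ?D S} \<union> {S. ?C S})"
    by (intro measure_pmf.finite_measure_mono subsetI UnCI CollectI) (auto simp del: subset_iff)
  also have "\<dots> \<le> measure_pmf.prob R {S. ?D S} + measure_pmf.prob R {S. ?C S}"
    by (rule measure_Un_le) auto
  also have "measure_pmf.prob R {S. ?D S} \<le> measure_pmf.prob R {S. A S} * measure_pmf.prob R {S. B S}"
    unfolding R_def by (rule van_den_Berg_Kesten) (fact assms(1-3) mono)+
  finally show ?thesis by simp
qed

text \<open>The signed double sum, diagonal included, is the variance of the count, so upper bounds
  on the single covariances are enough for Chebyshev.\<close>

lemma prob_count_ge_le:
  assumes "finite T" "t > 0"
    and cov: "(\<Sum>i\<in>T. \<Sum>j\<in>T. measure_pmf.prob R {S. Z i S \<and> Z j S}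
        - measure_pmf.prob R {S. Z i S} * measure_pmf.prob R {S. Z j S}) \<le> C"
  shows "measure_pmf.prob R {S. real (card {i\<in>T. Z i S}) \<ge> (\<Sum>i\<in>T. measure_pmf.prob R {S. Z i S}) + t}
      \<le> C / t\<^sup>2"
proof -
  define W where "W S = (\<Sum>i\<in>T. indicator {S. Z i S} S :: real)" for S
  have W: "W S = real (card {i\<in>T. Z i S})" for S
    unfolding W_def using assms(1) by (simp add: indicator_def sum.If_cases Int_def)
  have W2: "(W S)\<^sup>2 = (\<Sum>i\<in>T. \<Sum>j\<in>T. indicator {S. Z i S \<and> Z j S} S)" for S
    unfolding W_def power2_eq_square sum_product by (intro sum.cong refl) (auto simp: indicator_def)
  have int: "integrable (measure_pmf R) (indicator A :: _ \<Rightarrow> real)" for A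
    by (rule integrable_bounded_pmf[where B = 1]) (auto simp: indicator_def)
  have EW: "measure_pmf.expectation R W = (\<Sum>i\<in>T. measure_pmf.prob R {S. Z i S})"
    unfolding W_def using int by (subst Bochner_Integration.integral_sum) auto
  have EW2: "measure_pmf.expectation R (\<lambda>S. (W S)\<^sup>2)
      = (\<Sum>i\<in>T. \<Sum>j\<in>T. measure_pmf.prob R {S. Z i S \<and> Z j S})"
    unfolding W2 using int
    by (subst Bochner_Integration.integral_sum)
       (auto intro!: Bochner_Integration.integrable_sum sum.cong simp: Bochner_Integration.integral_sum)
  have iW: "integrable (measure_pmf R) W"
    unfolding W_def using int by (intro Bochner_Integration.integrable_sum) auto
  have iW2: "integrable (measure_pmf R) (\<lambda>S. (W S)\<^sup>2)"
    unfolding W2 using int by (intro Bochner_Integration.integrable_sum) auto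
  have "measure_pmf.variance R W = (\<Sum>i\<in>T. \<Sum>j\<in>T. measure_pmf.prob R {S. Z i S \<and> Z j S}
        - measure_pmf.prob R {S. Z i S} * measure_pmf.prob R {S. Z j S})"
    using measure_pmf.variance_eq[OF iW iW2] unfolding EW EW2
    by (simp add: power2_eq_square sum_product sum_subtractf)
  then have var: "measure_pmf.variance R W \<le> C" using cov by simp
  have "measure_pmf.prob R {S. real (card {i\<in>T. Z i S}) \<ge> (\<Sum>i\<in>T. measure_pmf.prob R {S. Z i S}) + t}
     \<le> measure_pmf.prob R {S\<in>space R. \<bar>W S - measure_pmf.expectation R W\<bar> \<ge> t}"
    unfolding EW W by (intro measure_pmf.finite_measure_mono) auto
  also have "\<dots> \<le> measure_pmf.variance R W / t\<^sup>2"
    using iW2 assms(2) by (intro measure_pmf.Chebyshev_inequality) auto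
  also have "\<dots> \<le> C / t\<^sup>2" using var by (simp add: divide_right_mono)
  finally show ?thesis .
qed

section \<open>Branches in the random hypergraph\<close>

lemma random_hypergraph_eq: "random_hypergraph r n p = random_subset (r_subsets r n) p"
  by (simp add: random_hypergraph_def random_subset_def)

lemma finite_r_subsets: "finite (r_subsets r n)"
  unfolding r_subsets_def by (rule finite_subset[of _ "Pow {1..n}"]) auto

lemma card_r_subsets_containing:
  assumes "v \<in> {1..n}" "r \<ge> 1"
  shows "card {e \<in> r_subsets r n. v \<in> e} = (n - 1) choose (r - 1)"
proof -
  let ?B = "{f. f \<subseteq> {1..n} - {v} \<and> card f = r - 1}"
  have "bij_betw (insert v) ?B {e \<in> r_subsets r n. v \<in> e}"
  proof (rule bij_betwI[where g = "\<lambda>e. e - {v}"])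
    show "insert v \<in> ?B \<rightarrow> {e \<in> r_subsets r n. v \<in> e}"
    proof
      fix f assume f: "f \<in> ?B"
      then have "finite f" "v \<notin> f" using finite_subset[of f "{1..n} - {v}"] by auto
      then have "card (insert v f) = r" using f assms(2) by simp
      then show "insert v f \<in> {e \<in> r_subsets r n. v \<in> e}"
        using f assms(1) by (auto simp: r_subsets_def)
    qed
    show "(\<lambda>e. e - {v}) \<in> {e \<in> r_subsets r n. v \<in> e} \<rightarrow> ?B"
    proof
      fix e assume e: "e \<in> {e \<in> r_subsets r n. v \<in> e}"
      then have "card (e - {v}) = r - 1" by (simp add: r_subsets_def)
      then show "e - {v} \<in> ?B" using e by (auto simp: r_subsets_def)
    qed
  qed auto
  then have "card {e \<in> r_subsets r n. v \<in> e} = card ?B"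
    by (rule bij_betw_same_card[symmetric])
  also have "\<dots> = (n - 1) choose (r - 1)"
    using n_subsets[of "{1..n} - {v}" "r - 1"] assms(1) by simp
  finally show ?thesis .
qed

text \<open>Double counting of incidences. With \<open>g = 1\<close> it counts the potential edges;
  applied twice it turns sums over pairs of edges into sums over pairs of vertices.\<close>

lemma sum_r_subsets_incident:
  fixes g :: "nat \<Rightarrow> real"
  assumes "r \<ge> 1"
  shows "(\<Sum>e\<in>r_subsets r n. \<Sum>w\<in>e. g w) = real ((n - 1) choose (r - 1)) * (\<Sum>w\<in>{1..n}. g w)"
proof -
  have "(\<Sum>e\<in>r_subsets r n. \<Sum>w\<in>e. g w) = (\<Sum>e\<in>r_subsets r n. \<Sum>w | w \<in> {1..n} \<and> w \<in> e. g w)"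
    by (intro sum.cong refl) (auto simp: r_subsets_def)
  also have "\<dots> = (\<Sum>w\<in>{1..n}. \<Sum>e | e \<in> r_subsets r n \<and> w \<in> e. g w)"
    by (rule sum.swap_restrict) (auto simp: finite_r_subsets)
  also have "\<dots> = (\<Sum>w\<in>{1..n}. real ((n - 1) choose (r - 1)) * g w)"
    using card_r_subsets_containing[of _ n r] assms by (intro sum.cong refl) simp
  finally show ?thesis by (simp add: sum_distrib_left)
qed

lemma card_r_subsets_times:
  assumes "r \<ge> 1"
  shows "real r * real (card (r_subsets r n)) = real n * real ((n - 1) choose (r - 1))"
proof -
  have "(\<Sum>e\<in>r_subsets r n. \<Sum>w\<in>e. 1) = real r * real (card (r_subsets r n))"
    by (subst sum.cong[OF refl, where h = "\<lambda>_. real r"]) (auto simp: r_subsets_def)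
  then show ?thesis using sum_r_subsets_incident[OF assms, of "\<lambda>_. 1" n] by simp
qed

text \<open>Survival to depth \<open>k\<close> in a branching process where a vertex has
  \<open>N\<close> potential edges, each present with probability \<open>p\<close> and offering
  \<open>r - 1\<close> independent exits; \<open>rho_approx\<close> is its limit.\<close>

fun reach_bound :: "nat \<Rightarrow> real \<Rightarrow> nat \<Rightarrow> nat \<Rightarrow> real" where
  "reach_bound r p N 0 = 1"
| "reach_bound r p N (Suc k) = 1 - (1 - p * (1 - (1 - reach_bound r p N k) ^ (r - 1))) ^ N"

lemma reach_bound_bounds:
  assumes "0 \<le> p" "p \<le> 1"
  shows "0 \<le> reach_bound r p N k \<and> reach_bound r p N k \<le> 1"
proof (induction k)
  case (Suc k)
  have "0 \<le> (1 - reach_bound r p N k) ^ (r - 1)" "(1 - reach_bound r p N k) ^ (r - 1) \<le> 1"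
    using Suc by (auto intro: power_le_one)
  then have "0 \<le> p * (1 - (1 - reach_bound r p N k) ^ (r - 1))"
      "p * (1 - (1 - reach_bound r p N k) ^ (r - 1)) \<le> 1"
    using assms by (auto intro!: mult_le_one)
  then show ?case by (auto intro!: power_le_one)
qed simp

definition branch_bound :: "nat \<Rightarrow> real \<Rightarrow> nat \<Rightarrow> nat \<Rightarrow> real" where
  "branch_bound r p N k = p * (1 - (1 - reach_bound r p N k) ^ (r - 1))"

lemma branch_bound_bounds:
  assumes "0 \<le> p" "p \<le> 1"
  shows "0 \<le> branch_bound r p N k \<and> branch_bound r p N k \<le> 1"
proof -
  have "0 \<le> (1 - reach_bound r p N k) ^ (r - 1)" "(1 - reach_bound r p N k) ^ (r - 1) \<le> 1"
    using reach_bound_bounds[OF assms, of r N k] by (auto intro: power_le_one)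
  then show ?thesis unfolding branch_bound_def using assms by (auto intro!: mult_le_one)
qed

text \<open>Here \<open>x = p * N\<close> is the expected degree, and one step multiplies the
  expected number of connections by at most \<open>r * x\<close>. For fixed \<open>M\<close> the sum
  stays bounded as long as \<open>x\<close> does.\<close>

definition conn_sum :: "nat \<Rightarrow> real \<Rightarrow> nat \<Rightarrow> real" where
  "conn_sum r x M = (\<Sum>m\<le>M. (real r * x) ^ m)"

context
  fixes r n N :: nat and p :: real and X :: "nat set set" and R :: "nat set set pmf"
  assumes r: "r \<ge> 2" and p: "0 \<le> p" "p \<le> 1"
  defines "N \<equiv> (n - 1) choose (r - 1)" and "X \<equiv> r_subsets r n" and "R \<equiv> random_subset X p"
begin

lemma finite_X: "finite X"
  by (simp add: X_def finite_r_subsets)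

lemma in_XD: "e \<in> X \<Longrightarrow> e \<subseteq> {1..n} \<and> finite e \<and> card e = r"
  unfolding X_def r_subsets_def using finite_subset[of e "{1..n}"] by auto

lemma card_incident: "v \<in> {1..n} \<Longrightarrow> card {e\<in>X. v \<in> e} = N"
  unfolding X_def N_def using r by (intro card_r_subsets_containing) auto

text \<open>The hypothesis on \<open>reach k\<close> is the induction hypothesis of
  \<open>prob_reach_le\<close>, whose step uses this bound. The edge costs \<open>p\<close>, and its
  \<open>r - 1\<close> exits are compared with independent ones.\<close>

lemma prob_branch_le_aux:
  assumes "\<And>w. w \<in> {1..n} \<Longrightarrow> measure_pmf.prob R {S. reach k w S} \<le> reach_bound r p N k"
    and "e \<in> X" "v \<in> e"
  shows "measure_pmf.prob R {S. branch k v e S} \<le> branch_bound r p N k"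
proof -
  have "measure_pmf.prob R {S. branch k v e S} =
      measure_pmf.prob R {S. e \<in> S \<and> (\<exists>w\<in>e - {v}. reach k w (S - {e}))}"
    using assms(3) by (simp add: branch_def)
  also have "\<dots> = p * measure_pmf.prob R {S. \<exists>w\<in>e - {v}. reach k w (S - {e})}"
    unfolding R_def using finite_X assms(2) p by (rule prob_member_and_rest)
  also have "\<dots> \<le> p * measure_pmf.prob R {S. \<exists>w\<in>e - {v}. reach k w S}"
    using p by (intro mult_left_mono prob_mono) (auto intro: reach_mono)
  also have "measure_pmf.prob R {S. \<exists>w\<in>e - {v}. reach k w S}
      \<le> 1 - (1 - reach_bound r p N k) ^ card (e - {v})"
    unfolding R_def
  proof (rule prob_union_le)
    fix w assume "w \<in> e - {v}"
    then show "measure_pmf.prob (random_subset X p) {S. reach k w S} \<le> reach_bound r p N k"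
      using assms(1)[of w] in_XD[OF assms(2)] unfolding R_def by auto
  qed (use reach_bound_bounds[OF p] finite_X in_XD[OF assms(2)] p in \<open>auto intro: reach_mono\<close>)
  also have "card (e - {v}) = r - 1" using in_XD[OF assms(2)] assms(3) by simp
  finally show ?thesis using p by (simp add: branch_bound_def mult_left_mono)
qed

lemma prob_reach_le:
  assumes "v \<in> {1..n}"
  shows "measure_pmf.prob R {S. reach k v S} \<le> reach_bound r p N k"
  using assms
proof (induction k arbitrary: v)
  case (Suc k)
  have "measure_pmf.prob R {S. reach (Suc k) v S} \<le>
      measure_pmf.prob R {S. \<exists>e\<in>{e\<in>X. v \<in> e}. branch k v e S}"
  proof (rule prob_mono)
    fix S assume "S \<in> set_pmf R" "reach (Suc k) v S"
    then obtain e where "e \<in> S" "branch k v e S" "S \<subseteq> X"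
      unfolding reach_Suc_iff_branch R_def using random_subset_subset by blast
    then show "\<exists>e\<in>{e\<in>X. v \<in> e}. branch k v e S" unfolding branch_def by blast
  qed
  also have "\<dots> \<le> 1 - (1 - branch_bound r p N k) ^ card {e\<in>X. v \<in> e}"
    unfolding R_def
  proof (rule prob_union_le)
    fix e assume "e \<in> {e\<in>X. v \<in> e}"
    then show "measure_pmf.prob (random_subset X p) {S. branch k v e S} \<le> branch_bound r p N k"
      using Suc.IH unfolding R_def[symmetric] by (intro prob_branch_le_aux) auto
  qed (use branch_bound_bounds[OF p] finite_X p in \<open>auto intro: branch_mono\<close>)
  finally show ?case using card_incident[OF Suc.prems] by (simp add: branch_bound_def)
qed simp

lemma prob_branch_le:
  "e \<in> X \<Longrightarrow> v \<in> e \<Longrightarrow> measure_pmf.prob R {S. branch k v e S} \<le> branch_bound r p N k"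
  by (intro prob_branch_le_aux prob_reach_le)

lemma prob_vertex_event_le:
  assumes "v \<in> {1..n}"
  shows "measure_pmf.prob R {S. vertex_event k v S} \<le> two_or_more N (branch_bound r p N k)"
proof -
  let ?I = "{e\<in>X. v \<in> e}"
  have "measure_pmf.prob R {S. vertex_event k v S} \<le> measure_pmf.prob R {S. \<exists>e\<in>?I. \<exists>f\<in>?I. e \<noteq> f \<and>
     (\<exists>K L. K \<subseteq> S \<and> L \<subseteq> S \<and> K \<inter> L = {} \<and> branch k v e K \<and> branch k v f L)}"
  proof (rule prob_mono)
    fix S assume S: "S \<in> set_pmf R" "vertex_event k v S"
    then have "S \<subseteq> X" unfolding R_def using random_subset_subset by blast
    obtain e f where ef: "e \<in> S" "f \<in> S" "e \<noteq> f"
        "\<exists>K L. K \<subseteq> S \<and> L \<subseteq> S \<and> K \<inter> L = {} \<and> branch k v e K \<and> branch k v f L"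
      using S(2) unfolding vertex_event_def by blast
    moreover from ef(4) have "v \<in> e" "v \<in> f" unfolding branch_def by blast+
    ultimately show "\<exists>e\<in>?I. \<exists>f\<in>?I. e \<noteq> f \<and>
        (\<exists>K L. K \<subseteq> S \<and> L \<subseteq> S \<and> K \<inter> L = {} \<and> branch k v e K \<and> branch k v f L)"
      using \<open>S \<subseteq> X\<close> by blast
  qed
  also have "\<dots> \<le> two_or_more (card ?I) (branch_bound r p N k)"
    unfolding R_def
  proof (rule prob_two_disjointly_le)
    fix e assume "e \<in> ?I"
    then show "measure_pmf.prob (random_subset X p) {S. branch k v e S} \<le> branch_bound r p N k"
      unfolding R_def[symmetric] by (intro prob_branch_le) auto
  qed (use branch_bound_bounds[OF p] finite_X p in \<open>auto intro: branch_mono\<close>)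
  finally show ?thesis using card_incident[OF assms] by simp
qed

lemma prob_edge_event_le:
  assumes "e \<in> X"
  shows "measure_pmf.prob R {S. edge_event k e S} \<le> p * two_or_more r (reach_bound r p N k)"
proof -
  \<comment> \<open>\<open>D (S - {e})\<close> does not depend on the presence of \<open>e\<close>;
    once the factor \<open>p\<close> is split off, passing to \<open>D S\<close> only increases the
    probability.\<close>
  define D where "D S \<longleftrightarrow> (\<exists>v\<in>e. \<exists>w\<in>e. v \<noteq> w \<and>
     (\<exists>K L. K \<subseteq> S \<and> L \<subseteq> S \<and> K \<inter> L = {} \<and> reach k v K \<and> reach k w L))" for S
  have D_mono: "D S \<Longrightarrow> S \<subseteq> S' \<Longrightarrow> D S'" for S S'
    unfolding D_def by (meson subset_trans)
  have "measure_pmf.prob R {S. edge_event k e S} = measure_pmf.prob R {S. e \<in> S \<and> D (S - {e})}"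
    by (simp add: edge_event_def D_def)
  also have "\<dots> = p * measure_pmf.prob R {S. D (S - {e})}"
    unfolding R_def using finite_X assms p by (rule prob_member_and_rest)
  also have "\<dots> \<le> p * measure_pmf.prob R {S. D S}"
    using p by (intro mult_left_mono prob_mono) (auto intro: D_mono)
  also have "measure_pmf.prob R {S. D S} \<le> two_or_more (card e) (reach_bound r p N k)"
    unfolding R_def D_def
  proof (rule prob_two_disjointly_le)
    fix v assume "v \<in> e"
    then show "measure_pmf.prob (random_subset X p) {S. reach k v S} \<le> reach_bound r p N k"
      unfolding R_def[symmetric] using in_XD[OF assms] by (intro prob_reach_le) auto
  qed (use reach_bound_bounds[OF p] finite_X in_XD[OF assms] p in \<open>auto intro: reach_mono\<close>)
  finally show ?thesis using in_XD[OF assms] p by (simp add: mult_left_mono)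
qed

text \<open>There are \<open>N\<close> candidates for the first edge, each costs \<open>p\<close>
  and offers \<open>r\<close> vertices to continue from. The induction bound is uniform in that
  vertex, so the factors multiply.\<close>

lemma sum_prob_conn_le:
  assumes "v \<in> {1..n}"
  shows "(\<Sum>u\<in>{1..n}. measure_pmf.prob R {S. conn m v u S}) \<le> (real r * (p * real N)) ^ m"
  using assms
proof (induction m arbitrary: v)
  case 0
  have "(\<Sum>u\<in>{1..n}. measure_pmf.prob R {S. conn 0 v u S}) = (\<Sum>u\<in>{1..n}. if v = u then 1 else 0)"
    by (intro sum.cong refl) auto
  then show ?case using 0 by simp
next
  case (Suc m)
  let ?I = "{e\<in>X. v \<in> e}" and ?P = "\<lambda>w u. measure_pmf.prob R {S. conn m w u S}"
  have fin: "finite ?I" using finite_X by simp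
  have step: "measure_pmf.prob R {S. conn (Suc m) v u S} \<le> (\<Sum>e\<in>?I. \<Sum>w\<in>e. p * ?P w u)" for u
  proof -
    have "measure_pmf.prob R {S. conn (Suc m) v u S} \<le>
        measure_pmf.prob R (\<Union>e\<in>?I. \<Union>w\<in>e. {S. e \<in> S \<and> conn m w u (S - {e})})"
      by (rule measure_pmf.finite_measure_mono_AE)
         (auto simp: AE_measure_pmf_iff R_def dest!: random_subset_subset)
    also have "\<dots> \<le> (\<Sum>e\<in>?I. measure_pmf.prob R (\<Union>w\<in>e. {S. e \<in> S \<and> conn m w u (S - {e})}))"
      by (rule measure_pmf.finite_measure_subadditive_finite) (use fin in auto)
    also have "\<dots> \<le> (\<Sum>e\<in>?I. \<Sum>w\<in>e. measure_pmf.prob R {S. e \<in> S \<and> conn m w u (S - {e})})"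
      by (intro sum_mono measure_pmf.finite_measure_subadditive_finite) (use in_XD in auto)
    also have "\<dots> \<le> (\<Sum>e\<in>?I. \<Sum>w\<in>e. p * ?P w u)"
    proof (intro sum_mono)
      fix e w assume e: "e \<in> ?I"
      then have "measure_pmf.prob R {S. e \<in> S \<and> conn m w u (S - {e})} =
          p * measure_pmf.prob R {S. conn m w u (S - {e})}"
        unfolding R_def using finite_X p by (intro prob_member_and_rest) auto
      also have "\<dots> \<le> p * ?P w u"
        using p by (intro mult_left_mono prob_mono) (auto intro: conn_mono)
      finally show "measure_pmf.prob R {S. e \<in> S \<and> conn m w u (S - {e})} \<le> p * ?P w u" .
    qed
    finally show ?thesis .
  qed
  have "(\<Sum>u\<in>{1..n}. measure_pmf.prob R {S. conn (Suc m) v u S})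
      \<le> (\<Sum>u\<in>{1..n}. \<Sum>e\<in>?I. \<Sum>w\<in>e. p * ?P w u)"
    by (intro sum_mono step)
  also have "\<dots> = (\<Sum>e\<in>?I. \<Sum>u\<in>{1..n}. \<Sum>w\<in>e. p * ?P w u)"
    by (rule sum.swap)
  also have "\<dots> = (\<Sum>e\<in>?I. \<Sum>w\<in>e. p * (\<Sum>u\<in>{1..n}. ?P w u))"
  proof (rule sum.cong[OF refl])
    fix e
    have "(\<Sum>u\<in>{1..n}. \<Sum>w\<in>e. p * ?P w u) = (\<Sum>w\<in>e. \<Sum>u\<in>{1..n}. p * ?P w u)"
      by (rule sum.swap)
    then show "(\<Sum>u\<in>{1..n}. \<Sum>w\<in>e. p * ?P w u) = (\<Sum>w\<in>e. p * (\<Sum>u\<in>{1..n}. ?P w u))"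
      by (simp add: sum_distrib_left)
  qed
  also have "\<dots> \<le> (\<Sum>e\<in>?I. \<Sum>w\<in>e. p * (real r * (p * real N)) ^ m)"
    using p in_XD by (intro sum_mono mult_left_mono Suc.IH) blast+
  also have "\<dots> = (\<Sum>e\<in>?I. real r * (p * (real r * (p * real N)) ^ m))"
    using in_XD by (intro sum.cong refl) auto
  also have "\<dots> = (real r * (p * real N)) ^ Suc m"
    using card_incident[OF Suc.prems] by simp
  finally show ?case .
qed

lemma sum_sum_prob_conn_le:
  "(\<Sum>v\<in>{1..n}. \<Sum>u\<in>{1..n}. \<Sum>m\<le>M. measure_pmf.prob R {S. conn m v u S}) \<le> real n * conn_sum r (p * real N) M"
proof -
  have "(\<Sum>v\<in>{1..n}. \<Sum>u\<in>{1..n}. \<Sum>m\<le>M. measure_pmf.prob R {S. conn m v u S})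
      = (\<Sum>v\<in>{1..n}. \<Sum>m\<le>M. \<Sum>u\<in>{1..n}. measure_pmf.prob R {S. conn m v u S})"
    by (intro sum.cong refl sum.swap)
  also have "\<dots> \<le> (\<Sum>v\<in>{1..n}. conn_sum r (p * real N) M)"
    unfolding conn_sum_def by (intro sum_mono sum_prob_conn_le)
  finally show ?thesis by simp
qed

lemma prob_conn_within_le:
  "measure_pmf.prob R {S. \<exists>m\<le>M. conn m v u S} \<le> (\<Sum>m\<le>M. measure_pmf.prob R {S. conn m v u S})"
proof -
  have "{S. \<exists>m\<le>M. conn m v u S} = (\<Union>m\<le>M. {S. conn m v u S})" by auto
  then show ?thesis using measure_pmf.finite_measure_subadditive_finite[of "{..M}"] by auto
qed

section \<open>Concentration of the two counts\<close>

lemma prob_many_vertex_events: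
  assumes "t > 0"
  shows "measure_pmf.prob R {S. real (card {v\<in>{1..n}. vertex_event k v S})
        \<ge> real n * two_or_more N (branch_bound r p N k) + t}
      \<le> real n * conn_sum r (p * real N) (2 * k + 3) / t\<^sup>2"
proof -
  let ?P = "\<lambda>v. measure_pmf.prob R {S. vertex_event k v S}"
  have "(\<Sum>v\<in>{1..n}. ?P v) \<le> (\<Sum>v\<in>{1..n}. two_or_more N (branch_bound r p N k))"
    by (intro sum_mono prob_vertex_event_le)
  then have "measure_pmf.prob R {S. real (card {v\<in>{1..n}. vertex_event k v S})
        \<ge> real n * two_or_more N (branch_bound r p N k) + t}
     \<le> measure_pmf.prob R {S. real (card {v\<in>{1..n}. vertex_event k v S}) \<ge> (\<Sum>v\<in>{1..n}. ?P v) + t}"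
    by (intro prob_mono) simp
  also have "\<dots> \<le> real n * conn_sum r (p * real N) (2 * k + 3) / t\<^sup>2"
  proof (rule prob_count_ge_le[OF _ assms])
    have "measure_pmf.prob R {S. vertex_event k v S \<and> vertex_event k u S} - ?P v * ?P u
        \<le> (\<Sum>m\<le>2 * k + 3. measure_pmf.prob R {S. conn m v u S})" for v u
    proof -
      \<comment> \<open>The neighbourhoods have radius \<open>Suc k\<close>, whence the distance
        bound \<open>2 * Suc k + 1 = 2 * k + 3\<close>.\<close>
      have "measure_pmf.prob R {S. vertex_event k v S \<and> vertex_event k u S} \<le> ?P v * ?P u +
         measure_pmf.prob R {S. vertex_event k v S \<and> vertex_event k u S \<and> (\<exists>m\<le>2 * Suc k + 1. conn m v u S)}"
        unfolding R_def
        by (rule prob_local_events_le[OF finite_X p])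
           (fact vertex_event_mono vertex_event_near)+
      also have "measure_pmf.prob R {S. vertex_event k v S \<and> vertex_event k u S \<and> (\<exists>m\<le>2 * Suc k + 1. conn m v u S)}
         \<le> measure_pmf.prob R {S. \<exists>m\<le>2 * k + 3. conn m v u S}"
        by (intro prob_mono) (simp add: numeral_3_eq_3)
      also note prob_conn_within_le
      finally show ?thesis by simp
    qed
    then have "(\<Sum>v\<in>{1..n}. \<Sum>u\<in>{1..n}. measure_pmf.prob R {S. vertex_event k v S \<and> vertex_event k u S} - ?P v * ?P u)
      \<le> (\<Sum>v\<in>{1..n}. \<Sum>u\<in>{1..n}. \<Sum>m\<le>2 * k + 3. measure_pmf.prob R {S. conn m v u S})"
      by (intro sum_mono)
    also note sum_sum_prob_conn_le
    finally show "(\<Sum>v\<in>{1..n}. \<Sum>u\<in>{1..n}. measure_pmf.prob R {S. vertex_event k v S \<and> vertex_event k u S} - ?P v * ?P u)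
      \<le> real n * conn_sum r (p * real N) (2 * k + 3)" .
  qed simp
  finally show ?thesis .
qed

text \<open>The base points \<open>a\<close> and \<open>b\<close> only locate the neighbourhoods.
  The connection is relaxed to one between arbitrary vertices of \<open>e\<close> and
  \<open>f\<close> that avoids both edges, hence independent of their presence.\<close>

lemma edge_event_covariance_le:
  assumes "e \<in> X" "f \<in> X" "e \<noteq> f"
  shows "measure_pmf.prob R {S. edge_event k e S \<and> edge_event k f S}
       - measure_pmf.prob R {S. edge_event k e S} * measure_pmf.prob R {S. edge_event k f S}
     \<le> p\<^sup>2 * (\<Sum>w\<in>e. \<Sum>u\<in>f. \<Sum>m\<le>2 * k + 3. measure_pmf.prob R {S. conn m u w S})"
proof -
  let ?M = "2 * k + 3"
  have ne: "finite e" "finite f" "e \<noteq> {}" "f \<noteq> {}" using in_XD assms r by fastforce+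
  then obtain a b where ab: "a \<in> e" "b \<in> f" by blast
  define Q where "Q S \<longleftrightarrow> (\<exists>w\<in>e. \<exists>u\<in>f. \<exists>m\<le>?M. conn m u w S)" for S
  have Q_mono: "Q S \<Longrightarrow> S \<subseteq> S' \<Longrightarrow> Q S'" for S S'
    unfolding Q_def by (meson conn_mono)
  have "measure_pmf.prob R {S. edge_event k e S \<and> edge_event k f S} \<le>
      measure_pmf.prob R {S. edge_event k e S} * measure_pmf.prob R {S. edge_event k f S} +
      measure_pmf.prob R {S. edge_event k e S \<and> edge_event k f S \<and> (\<exists>m\<le>2 * Suc k + 1. conn m a b S)}"
    unfolding R_def
    by (rule prob_local_events_le[OF finite_X p])
       (fact edge_event_mono edge_event_near[OF _ ab(1)] edge_event_near[OF _ ab(2)])+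
  \<comment> \<open>The nesting lets \<open>prob_member_and_rest\<close> split off \<open>e\<close>
    and then \<open>f\<close>.\<close>
  also have "measure_pmf.prob R {S. edge_event k e S \<and> edge_event k f S \<and> (\<exists>m\<le>2 * Suc k + 1. conn m a b S)}
      \<le> measure_pmf.prob R {S. e \<in> S \<and> (f \<in> S - {e} \<and> Q (S - {e} - {f}))}"
  proof (intro prob_mono)
    fix S assume S: "edge_event k e S \<and> edge_event k f S \<and> (\<exists>m\<le>2 * Suc k + 1. conn m a b S)"
    then obtain m where "m \<le> ?M" "conn m a b S" by (auto simp: numeral_3_eq_3)
    with conn_delete_two_edges[OF this(2) ab] have "Q (S - {e} - {f})"
      unfolding Q_def by (meson order_trans)
    then show "e \<in> S \<and> (f \<in> S - {e} \<and> Q (S - {e} - {f}))"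
      using S assms(3) by (auto simp: edge_event_def)
  qed
  also have "\<dots> = p * measure_pmf.prob R {S. f \<in> S - {e} \<and> Q (S - {e} - {f})}"
    unfolding R_def using finite_X assms(1) p by (rule prob_member_and_rest)
  also have "\<dots> \<le> p * measure_pmf.prob R {S. f \<in> S \<and> Q (S - {f})}"
    using p by (intro mult_left_mono prob_mono) (auto intro: Q_mono)
  also have "measure_pmf.prob R {S. f \<in> S \<and> Q (S - {f})} = p * measure_pmf.prob R {S. Q (S - {f})}"
    unfolding R_def using finite_X assms(2) p by (rule prob_member_and_rest)
  also have "measure_pmf.prob R {S. Q (S - {f})} \<le> measure_pmf.prob R {S. Q S}"
    by (intro prob_mono) (auto intro: Q_mono)
  also have "{S. Q S} = (\<Union>w\<in>e. \<Union>u\<in>f. {S. \<exists>m\<le>?M. conn m u w S})"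
    by (auto simp: Q_def)
  also have "measure_pmf.prob R \<dots> \<le> (\<Sum>w\<in>e. measure_pmf.prob R (\<Union>u\<in>f. {S. \<exists>m\<le>?M. conn m u w S}))"
    using ne by (intro measure_pmf.finite_measure_subadditive_finite) auto
  also have "\<dots> \<le> (\<Sum>w\<in>e. \<Sum>u\<in>f. measure_pmf.prob R {S. \<exists>m\<le>?M. conn m u w S})"
    using ne by (intro sum_mono measure_pmf.finite_measure_subadditive_finite) auto
  also have "\<dots> \<le> (\<Sum>w\<in>e. \<Sum>u\<in>f. \<Sum>m\<le>?M. measure_pmf.prob R {S. conn m u w S})"
    by (intro sum_mono prob_conn_within_le)
  finally show ?thesis
    using p by (simp add: power2_eq_square mult_left_mono mult.assoc)
qed

lemma prob_many_edge_events:
  assumes "t > 0"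
  shows "measure_pmf.prob R {S. real (card {e\<in>X. edge_event k e S})
        \<ge> real (card X) * (p * two_or_more r (reach_bound r p N k)) + t}
      \<le> (p * real (card X) + (p * real N)\<^sup>2 * (real n * conn_sum r (p * real N) (2 * k + 3))) / t\<^sup>2"
proof -
  let ?P = "\<lambda>e. measure_pmf.prob R {S. edge_event k e S}"
  let ?g = "\<lambda>u w. \<Sum>m\<le>2 * k + 3. measure_pmf.prob R {S. conn m u w S}"
  have g: "0 \<le> ?g u w" for u w by (intro sum_nonneg) simp
  have "(\<Sum>e\<in>X. ?P e) \<le> (\<Sum>e\<in>X. p * two_or_more r (reach_bound r p N k))"
    by (intro sum_mono prob_edge_event_le)
  then have "measure_pmf.prob R {S. real (card {e\<in>X. edge_event k e S})
        \<ge> real (card X) * (p * two_or_more r (reach_bound r p N k)) + t}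
     \<le> measure_pmf.prob R {S. real (card {e\<in>X. edge_event k e S}) \<ge> (\<Sum>e\<in>X. ?P e) + t}"
    by (intro prob_mono) simp
  also have "\<dots> \<le> (p * real (card X) + (p * real N)\<^sup>2 * (real n * conn_sum r (p * real N) (2 * k + 3))) / t\<^sup>2"
  proof (rule prob_count_ge_le[OF finite_X assms])
    have "measure_pmf.prob R {S. edge_event k e S \<and> edge_event k f S} - ?P e * ?P f
        \<le> (if e = f then p else 0) + p\<^sup>2 * (\<Sum>w\<in>e. \<Sum>u\<in>f. ?g u w)" if "e \<in> X" "f \<in> X" for e f
    proof (cases "e = f")
      case True
      \<comment> \<open>The covariance lemma needs distinct edges. On the diagonal the probability
        \<open>p\<close> of the edge suffices: these terms sum to \<open>p * card X\<close>, the
        expected number of edges.\<close>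
      have "?P e \<le> measure_pmf.prob R {S. e \<in> S \<and> True}"
        by (intro prob_mono) (auto simp: edge_event_def)
      also have "\<dots> = p"
        unfolding R_def using prob_member_and_rest[OF finite_X that(1) p, of "\<lambda>_. True"] by simp
      finally have "?P e \<le> p" .
      moreover have "0 \<le> ?P e * ?P e" by simp
      ultimately have "?P e - ?P e * ?P e \<le> p" by linarith
      moreover have "0 \<le> p\<^sup>2 * (\<Sum>w\<in>e. \<Sum>u\<in>e. ?g u w)"
        by (intro mult_nonneg_nonneg sum_nonneg g) simp
      ultimately show ?thesis using True by simp
    next
      case False
      then show ?thesis using edge_event_covariance_le[OF that] by simp
    qed
    then have "(\<Sum>e\<in>X. \<Sum>f\<in>X. measure_pmf.prob R {S. edge_event k e S \<and> edge_event k f S} - ?P e * ?P f)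
      \<le> (\<Sum>e\<in>X. \<Sum>f\<in>X. (if e = f then p else 0) + p\<^sup>2 * (\<Sum>w\<in>e. \<Sum>u\<in>f. ?g u w))"
      by (intro sum_mono)
    also have "\<dots> = p * real (card X) + p\<^sup>2 * (\<Sum>e\<in>X. \<Sum>f\<in>X. \<Sum>w\<in>e. \<Sum>u\<in>f. ?g u w)"
      using finite_X by (simp add: sum.distrib sum_distrib_left)
    also have "(\<Sum>e\<in>X. \<Sum>f\<in>X. \<Sum>w\<in>e. \<Sum>u\<in>f. ?g u w) = (\<Sum>e\<in>X. \<Sum>w\<in>e. \<Sum>f\<in>X. \<Sum>u\<in>f. ?g u w)"
      by (intro sum.cong refl sum.swap)
    \<comment> \<open>Counting incidences first for \<open>f\<close> and then for \<open>e\<close>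
      leaves \<open>N\<^sup>2\<close>, which the factor \<open>p\<^sup>2\<close>
      compensates.\<close>
    also have "\<dots> = (\<Sum>e\<in>X. \<Sum>w\<in>e. real N * (\<Sum>u\<in>{1..n}. ?g u w))"
      unfolding X_def N_def using r by (intro sum.cong refl sum_r_subsets_incident) auto
    also have "\<dots> = real N * (\<Sum>w\<in>{1..n}. real N * (\<Sum>u\<in>{1..n}. ?g u w))"
      unfolding X_def N_def using r by (intro sum_r_subsets_incident) auto
    also have "\<dots> = (real N)\<^sup>2 * (\<Sum>u\<in>{1..n}. \<Sum>w\<in>{1..n}. ?g u w)"
      by (subst sum.swap) (simp add: power2_eq_square sum_distrib_left mult.assoc)
    also have "\<dots> \<le> (real N)\<^sup>2 * (real n * conn_sum r (p * real N) (2 * k + 3))"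
      by (intro mult_left_mono sum_sum_prob_conn_le) simp
    finally show "(\<Sum>e\<in>X. \<Sum>f\<in>X. measure_pmf.prob R {S. edge_event k e S \<and> edge_event k f S} - ?P e * ?P f)
      \<le> p * real (card X) + (p * real N)\<^sup>2 * (real n * conn_sum r (p * real N) (2 * k + 3))"
      by (simp add: power_mult_distrib mult_left_mono mult.assoc)
  qed
  finally show ?thesis .
qed

end

section \<open>Limits\<close>

text \<open>For the upper estimate of \<open>exp (- q)\<close>, multiply by \<open>1 + q\<close>:
  \<open>(1 + q) * (1 - q + q\<^sup>2) = 1 + q ^ 3\<close> is at least 1, whereas
  \<open>(1 + q) * exp (- q)\<close> is at most 1.\<close>

lemma exp_minus_bounds:
  fixes q :: real
  assumes "0 \<le> q"
  shows "\<bar>(1 - q) - exp (- q)\<bar> \<le> q\<^sup>2"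
proof -
  have "1 - q \<le> exp (- q)" using exp_ge_add_one_self[of "- q"] by simp
  moreover have "exp (- q) \<le> 1 - q + q\<^sup>2"
  proof -
    have "1 * exp (- q) \<le> (1 + q) * (1 - q + q\<^sup>2) * exp (- q)"
    proof (rule mult_right_mono)
      have "(1 + q) * (1 - q + q\<^sup>2) = 1 + q ^ 3"
        by (simp add: algebra_simps power2_eq_square power3_eq_cube)
      then show "1 \<le> (1 + q) * (1 - q + q\<^sup>2)" using assms by simp
    qed simp
    also have "\<dots> = (1 - q + q\<^sup>2) * ((1 + q) * exp (- q))" by simp
    also have "\<dots> \<le> (1 - q + q\<^sup>2) * 1"
    proof (rule mult_left_mono)
      have "(1 + q) * exp (- q) \<le> exp q * exp (- q)"
        using exp_ge_add_one_self[of q] by (intro mult_right_mono) auto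
      then show "(1 + q) * exp (- q) \<le> 1" by (simp add: exp_minus)
      have "(0::real) \<le> (1/2 - q)\<^sup>2 + 3/4" by simp
      also have "\<dots> = 1 - q + q\<^sup>2" by (simp add: power2_eq_square algebra_simps)
      finally show "0 \<le> 1 - q + q\<^sup>2" .
    qed
    finally show ?thesis by simp
  qed
  ultimately show ?thesis unfolding abs_le_iff using zero_le_power2[of q] by linarith
qed

text \<open>The powers differ by at most \<open>N n\<close> times the difference of their bases,
  thus by at most \<open>N n * (q n)\<^sup>2\<close>, which tends to \<open>y * 0\<close>.\<close>

lemma power_one_minus_tendsto_exp:
  fixes q :: "nat \<Rightarrow> real" and N :: "nat \<Rightarrow> nat"
  assumes "\<forall>\<^sub>F n in sequentially. 0 \<le> q n \<and> q n \<le> 1" "q \<longlonglongrightarrow> 0"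
    and lim: "(\<lambda>n. real (N n) * q n) \<longlonglongrightarrow> y"
  shows "(\<lambda>n. (1 - q n) ^ N n) \<longlonglongrightarrow> exp (- y)"
proof -
  have "(\<lambda>n. real (N n) * q n * q n) \<longlonglongrightarrow> y * 0"
    by (intro tendsto_mult assms)
  then have z: "(\<lambda>n. real (N n) * (q n)\<^sup>2) \<longlonglongrightarrow> 0" by (simp add: power2_eq_square mult.assoc)
  have "(\<lambda>n. (1 - q n) ^ N n - exp (- q n) ^ N n) \<longlonglongrightarrow> 0"
  proof (rule Lim_null_comparison[OF _ z])
    show "\<forall>\<^sub>F n in sequentially. norm ((1 - q n) ^ N n - exp (- q n) ^ N n) \<le> real (N n) * (q n)\<^sup>2"
      using assms(1)
    proof eventually_elim
      case (elim n)
      have "norm ((1 - q n) ^ N n - exp (- q n) ^ N n) \<le> real (N n) * norm ((1 - q n) - exp (- q n))"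
        using elim by (intro norm_power_diff) auto
      also have "\<dots> \<le> real (N n) * (q n)\<^sup>2"
        using exp_minus_bounds[of "q n"] elim by (intro mult_left_mono) auto
      finally show ?case .
    qed
  qed
  moreover have "(\<lambda>n. exp (- q n) ^ N n) \<longlonglongrightarrow> exp (- y)"
  proof -
    have "(\<lambda>n. exp (- (real (N n) * q n))) \<longlonglongrightarrow> exp (- y)" by (intro tendsto_intros lim)
    then show ?thesis by (simp add: exp_of_nat_mult[symmetric])
  qed
  ultimately have "(\<lambda>n. ((1 - q n) ^ N n - exp (- q n) ^ N n) + exp (- q n) ^ N n) \<longlonglongrightarrow> 0 + exp (- y)"
    by (rule tendsto_add)
  then show ?thesis by simp
qed

lemma two_or_more_tendsto_poisson:
  fixes q :: "nat \<Rightarrow> real" and N :: "nat \<Rightarrow> nat"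
  assumes "\<forall>\<^sub>F n in sequentially. 0 \<le> q n \<and> q n \<le> 1" "q \<longlonglongrightarrow> 0"
    and lim: "(\<lambda>n. real (N n) * q n) \<longlonglongrightarrow> y" and N: "\<forall>\<^sub>F n in sequentially. N n > 0"
  shows "(\<lambda>n. two_or_more (N n) (q n)) \<longlonglongrightarrow> 1 - exp (- y) - y * exp (- y)"
proof -
  have pow: "(\<lambda>n. (1 - q n) ^ N n) \<longlonglongrightarrow> exp (- y)"
    by (rule power_one_minus_tendsto_exp) (fact assms)+
  \<comment> \<open>Dividing by \<open>1 - q n\<close> trades the exponent \<open>N n - 1\<close>
    for \<open>N n\<close>; both forms agree once \<open>N n > 0\<close> and
    \<open>q n < 1\<close>.\<close>
  have "(\<lambda>n. 1 - (1 - q n) ^ N n - real (N n) * q n * ((1 - q n) ^ N n / (1 - q n)))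
      \<longlonglongrightarrow> 1 - exp (- y) - y * (exp (- y) / (1 - 0))"
    by (intro tendsto_intros pow assms) simp
  moreover have "\<forall>\<^sub>F n in sequentially. q n < 1"
    using order_tendstoD(2)[OF assms(2), of 1] by simp
  then have "\<forall>\<^sub>F n in sequentially. 1 - (1 - q n) ^ N n - real (N n) * q n * ((1 - q n) ^ N n / (1 - q n))
      = two_or_more (N n) (q n)"
    using N
  proof eventually_elim
    case (elim n)
    then obtain m where "N n = Suc m" using gr0_implies_Suc by blast
    then show ?case using elim by (simp add: two_or_more_def)
  qed
  ultimately show ?thesis
    by (simp add: Lim_transform_eventually)
qed

text \<open>The survival probabilities of the limiting branching process up to generation \<open>k\<close>.\<close>

fun rho_approx :: "nat \<Rightarrow> real \<Rightarrow> nat \<Rightarrow> real" where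
  "rho_approx r d 0 = 1"
| "rho_approx r d (Suc k) = 1 - F_fun r d (1 - rho_approx r d k)"

section \<open>Convergence of the survival probabilities to the largest fixed point\<close>

lemma F_fun_mono: "0 < d \<Longrightarrow> 0 \<le> x \<Longrightarrow> x \<le> y \<Longrightarrow> F_fun r d x \<le> F_fun r d y"
  unfolding F_fun_def by (auto intro!: mult_left_mono power_mono)

lemma F_fun_pos: "0 < F_fun r d x"
  by (simp add: F_fun_def)

lemma rho_approx_le_1: "rho_approx r d k \<le> 1"
  using F_fun_pos[of r d] by (cases k) (auto intro: less_imp_le)

lemma rho_star_le_approx:
  assumes "0 < d"
  shows "rho_star r d \<le> rho_approx r d k"
proof (induction k)
  case (Suc k)
  then have "F_fun r d (1 - rho_approx r d k) \<le> F_fun r d (1 - rho_star r d)"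
    using rho_approx_le_1[of r d k] assms by (intro F_fun_mono) auto
  then show ?case using rho_star_greatest(2)[of r d] unfolding rho_approx.simps by linarith
qed (use rho_star_greatest(1)[of r d] in simp)

lemma rho_approx_Suc_le:
  assumes "0 < d"
  shows "rho_approx r d (Suc k) \<le> rho_approx r d k"
proof (induction k)
  case 0
  then show ?case using rho_approx_le_1[of r d "Suc 0"] by simp
next
  case (Suc k)
  then have "F_fun r d (1 - rho_approx r d k) \<le> F_fun r d (1 - rho_approx r d (Suc k))"
    using rho_approx_le_1[of r d k] assms by (intro F_fun_mono) auto
  then show ?case by simp
qed

text \<open>By monotonicity of \<open>F_fun\<close> the iterates decrease and stay above
  \<open>rho_star\<close>. By continuity their limit is a solution, so it is at most the largest
  one.\<close>

lemma rho_approx_tendsto: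
  assumes "0 < d"
  shows "rho_approx r d \<longlonglongrightarrow> rho_star r d"
proof -
  have dec: "decseq (rho_approx r d)"
    using rho_approx_Suc_le[OF assms] by (intro decseq_SucI)
  have "\<forall>k. rho_star r d \<le> rho_approx r d k" using rho_star_le_approx[OF assms] by (rule allI)
  from decseq_convergent[OF dec this] obtain l where l: "rho_approx r d \<longlonglongrightarrow> l" by metis
  have ge: "rho_star r d \<le> l"
    by (rule LIMSEQ_le_const[OF l]) (intro exI[of _ 0] allI impI rho_star_le_approx assms)
  have le1: "l \<le> 1"
    by (rule LIMSEQ_le_const2[OF l]) (intro exI[of _ 0] allI impI rho_approx_le_1)
  have "(\<lambda>k. rho_approx r d (Suc k)) \<longlonglongrightarrow> 1 - F_fun r d (1 - l)"
    unfolding rho_approx.simps F_fun_def by (intro tendsto_intros l)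
  moreover have "(\<lambda>k. rho_approx r d (Suc k)) \<longlonglongrightarrow> l"
    using l by (rule LIMSEQ_Suc)
  ultimately have "1 - F_fun r d (1 - l) = l" by (rule LIMSEQ_unique)
  then have "0 \<le> 1 - l" "1 - l = F_fun r d (1 - l)" using le1 by linarith+
  then have "l \<le> rho_star r d" by (rule rho_star_greatest(3))
  with ge l show ?thesis by simp
qed

text \<open>A diagonal argument: convergence for every fixed slack becomes convergence along one
  null sequence of slacks, which is the meaning of \<open>o(1)\<close>. \<open>D n\<close> holds the
  slacks that exceed or equal their own failure probability.\<close>

lemma exists_null_sequence_of_thresholds:
  fixes g :: "nat \<Rightarrow> real \<Rightarrow> real"
  assumes mono: "\<And>n x y. x \<le> y \<Longrightarrow> g n x \<le> g n y"
    and bounds: "\<And>n x. 0 \<le> g n x" "\<And>n x. g n x \<le> 1"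
    and lim: "\<And>x. x > 0 \<Longrightarrow> (\<lambda>n. g n x) \<longlonglongrightarrow> 1"
  shows "\<exists>\<epsilon>. \<epsilon> \<longlonglongrightarrow> 0 \<and> (\<lambda>n. g n (\<epsilon> n)) \<longlonglongrightarrow> 1"
proof -
  define D where "D n = {x. 0 < x \<and> g n x \<ge> 1 - x}" for n
  \<comment> \<open>The infimum need not lie in \<open>D n\<close>; the added term passes strictly
    beyond it to a point above some member, where monotonicity applies.\<close>
  define \<epsilon> where "\<epsilon> n = Inf (D n) + 1 / real (Suc n)" for n
  have bdd: "bdd_below (D n)" for n by (rule bdd_belowI[of _ 0]) (auto simp: D_def)
  \<comment> \<open>The slack 1 always qualifies, since \<open>g\<close> is nonnegative.\<close>
  have ne: "D n \<noteq> {}" for n using bounds(1)[of n 1] by (auto simp: D_def intro!: exI[of _ 1])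
  have pos: "0 \<le> Inf (D n)" for n using ne by (intro cInf_greatest) (auto simp: D_def)
  have Inf0: "(\<lambda>n. Inf (D n)) \<longlonglongrightarrow> 0"
  proof (rule LIMSEQ_I)
    fix e :: real assume e: "e > 0"
    then have "\<forall>\<^sub>F n in sequentially. g n (e / 2) > 1 - e / 2"
      using order_tendstoD(1)[OF lim[of "e / 2"], of "1 - e / 2"] by simp
    then obtain n0 where n0: "\<And>n. n \<ge> n0 \<Longrightarrow> g n (e / 2) > 1 - e / 2"
      by (auto simp: eventually_sequentially)
    have "norm (Inf (D n) - 0) < e" if "n \<ge> n0" for n
    proof -
      have "e / 2 \<in> D n" using n0[OF that] e by (simp add: D_def)
      then have "Inf (D n) \<le> e / 2" using bdd by (intro cInf_lower)
      then show ?thesis using pos[of n] e by simp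
    qed
    then show "\<exists>no. \<forall>n\<ge>no. norm (Inf (D n) - 0) < e" by blast
  qed
  have \<epsilon>0: "\<epsilon> \<longlonglongrightarrow> 0"
    unfolding \<epsilon>_def using tendsto_add[OF Inf0 LIMSEQ_Suc[OF lim_1_over_n]] by simp
  have "1 - \<epsilon> n \<le> g n (\<epsilon> n)" for n
  proof -
    have "Inf (D n) < \<epsilon> n" by (simp add: \<epsilon>_def)
    then obtain x where "x \<in> D n" "x < \<epsilon> n" using cInf_lessD[OF ne] by blast
    then show ?thesis using mono[of x "\<epsilon> n" n] by (auto simp: D_def)
  qed
  moreover have "(\<lambda>n. 1 - \<epsilon> n) \<longlonglongrightarrow> 1" using tendsto_diff[OF tendsto_const \<epsilon>0, of 1] by simp
  ultimately have "(\<lambda>n. g n (\<epsilon> n)) \<longlonglongrightarrow> 1"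
    using bounds(2) by (intro tendsto_sandwich[of "\<lambda>n. 1 - \<epsilon> n" "\<lambda>n. g n (\<epsilon> n)" _ "\<lambda>_. 1"]) auto
  with \<epsilon>0 show ?thesis by blast
qed

lemma choose_at_top:
  assumes "k \<ge> 1"
  shows "filterlim (\<lambda>n. real ((n - 1) choose k)) at_top sequentially"
proof (rule filterlim_at_top_mono)
  show "filterlim (\<lambda>n. (real n - 1) / real k) at_top sequentially"
  proof -
    have "filterlim (\<lambda>n. 1 / real k * (- 1 + real n)) at_top sequentially"
      using assms
      by (intro filterlim_tendsto_pos_mult_at_top[OF tendsto_const]
          filterlim_tendsto_add_at_top[OF tendsto_const filterlim_real_sequentially]) auto
    then show ?thesis by simp
  qed
  show "\<forall>\<^sub>F n in sequentially. (real n - 1) / real k \<le> real ((n - 1) choose k)"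
    using eventually_ge_at_top[of "k + 1"]
  proof eventually_elim
    case (elim n)
    have "(real n - 1) / real k = real (n - 1) / real k" using elim by (simp add: of_nat_diff)
    also have "\<dots> \<le> (real (n - 1) / real k) ^ k"
      using elim assms by (intro self_le_power) (auto simp: field_simps)
    also have "\<dots> \<le> real ((n - 1) choose k)"
      using binomial_ge_n_over_k_pow_k[of k "n - 1", where 'a = real] elim by simp
    finally show ?case .
  qed
qed

section \<open>The longest loose path\<close>

lemma longest_loose_path_attained:
  assumes "r \<ge> 2" "finite V" "V \<noteq> {}"
  shows "\<exists>v e. loose_path r V E (longest_loose_path r V E) v e"
  using Max_in[OF loose_path_lengths_finite[OF assms(1,2)]] loose_path_lengths_nonempty[OF assms(3)]
  unfolding longest_loose_path_def by blast

text \<open>Edges are counted over the fixed set \<open>X\<close>, because the second-moment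
  estimate needs an index set that does not depend on the random \<open>E\<close>.\<close>

lemma longest_loose_path_le_events:
  assumes "r \<ge> 2" "finite V" "V \<noteq> {}" "finite X" "E \<subseteq> X"
  shows "longest_loose_path r V E \<le> card {e\<in>X. edge_event k e E} + 2 * k"
    and "longest_loose_path r V E \<le> card {v\<in>V. vertex_event k v E} + 2 * k + 1"
proof -
  obtain v e where path: "loose_path r V E (longest_loose_path r V E) v e"
    using longest_loose_path_attained[OF assms(1-3)] by blast
  have "card {e\<in>E. edge_event k e E} \<le> card {e\<in>X. edge_event k e E}"
    using assms(4,5) by (intro card_mono) auto
  then show "longest_loose_path r V E \<le> card {e\<in>X. edge_event k e E} + 2 * k"
    using path_length_le_edge_events[OF assms(1) path finite_subset[OF assms(5,4)], of k] by linarith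
  show "longest_loose_path r V E \<le> card {v\<in>V. vertex_event k v E} + 2 * k + 1"
    by (rule path_length_le_vertex_events[OF assms(1) path assms(2)])
qed

text \<open>A path that is too long forces one of the two counts above its threshold. The union
  bound adds the two Chebyshev estimates, and the end corrections \<open>2 * k\<close> and
  \<open>2 * k + 1\<close> are merged into the larger.\<close>

lemma prob_longest_loose_path_le:
  fixes r n k :: nat and p t :: real
  assumes r: "r \<ge> 2" and n: "n \<ge> 1" and p: "0 \<le> p" "p \<le> 1" and t: "t > 0"
  defines "N \<equiv> (n - 1) choose (r - 1)" and "X \<equiv> r_subsets r n"
  defines "C \<equiv> real n * conn_sum r (p * real N) (2 * k + 3)"
  defines "a \<equiv> real (card X) * (p * two_or_more r (reach_bound r p N k))"
    and "b \<equiv> real n * two_or_more N (branch_bound r p N k)"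
  shows "1 - (p * real (card X) + (p * real N)\<^sup>2 * C + C) / t\<^sup>2
     \<le> measure_pmf.prob (random_hypergraph r n p)
          {E. real (longest_loose_path r {1..n} E) \<le> min a b + t + real (2 * k + 1)}"
proof -
  define R where "R = random_subset X p"
  let ?good = "{E. real (longest_loose_path r {1..n} E) \<le> min a b + t + real (2 * k + 1)}"
  let ?bad1 = "{S. real (card {e\<in>X. edge_event k e S}) \<ge> a + t}"
  let ?bad2 = "{S. real (card {v\<in>{1..n}. vertex_event k v S}) \<ge> b + t}"
  have "1 \<le> measure_pmf.prob R (?good \<union> (?bad1 \<union> ?bad2))"
  proof -
    have "E \<in> ?good \<union> (?bad1 \<union> ?bad2)" if "E \<in> set_pmf R" for E
    proof -
      have "E \<subseteq> X" using that random_subset_subset unfolding R_def by blast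
      moreover have "finite X" by (simp add: X_def finite_r_subsets)
      moreover have "{1..n} \<noteq> {}" using n by simp
      ultimately have "longest_loose_path r {1..n} E \<le> card {e\<in>X. edge_event k e E} + 2 * k"
        "longest_loose_path r {1..n} E \<le> card {v\<in>{1..n}. vertex_event k v E} + 2 * k + 1"
        using longest_loose_path_le_events[OF r, of "{1..n}" X E k] by blast+
      then have "real (longest_loose_path r {1..n} E) \<le> real (card {e\<in>X. edge_event k e E}) + real (2 * k + 1)"
        "real (longest_loose_path r {1..n} E) \<le> real (card {v\<in>{1..n}. vertex_event k v E}) + real (2 * k + 1)"
        by linarith+
      then show ?thesis by (simp only: Un_iff mem_Collect_eq min_def) (smt (verit))
    qed
    then have "measure_pmf.prob R (?good \<union> (?bad1 \<union> ?bad2)) = 1"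
      by (intro measure_pmf.prob_eq_1[THEN iffD2]) (simp_all only: AE_measure_pmf_iff, auto)
    then show ?thesis by simp
  qed
  also have "\<dots> \<le> measure_pmf.prob R ?good + measure_pmf.prob R (?bad1 \<union> ?bad2)"
    by (rule measure_Un_le) auto
  also have "measure_pmf.prob R (?bad1 \<union> ?bad2) \<le> measure_pmf.prob R ?bad1 + measure_pmf.prob R ?bad2"
    by (rule measure_Un_le) auto
  also have "measure_pmf.prob R ?bad1 \<le> (p * real (card X) + (p * real N)\<^sup>2 * C) / t\<^sup>2"
    unfolding R_def X_def a_def N_def C_def by (rule prob_many_edge_events[OF r p t])
  also have "measure_pmf.prob R ?bad2 \<le> C / t\<^sup>2"
    unfolding R_def X_def b_def N_def C_def by (rule prob_many_vertex_events[OF r p t])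
  finally show ?thesis
    unfolding random_hypergraph_eq X_def[symmetric] R_def[symmetric] by (simp add: add_divide_distrib)
qed

text \<open>
  How \<open>\<eta>\<close> is spent: half of it pays for replacing \<open>\<rho>\<^sub>*\<close> by the depth-\<open>k\<close>
  approximation and the limiting constants by their values at \<open>n\<close>, a quarter for the fluctuations,
  and a quarter for the at most \<open>2 k + 1\<close> edges near the ends of the path.
\<close>

lemma longest_loose_path_linear_bound:
  fixes r :: nat and d :: real and d_seq :: "nat \<Rightarrow> real" and p :: "nat \<Rightarrow> real"
  assumes r: "r \<ge> 3" and d: "d > 0" and d_seq: "d_seq \<longlonglongrightarrow> d"
    and p_def: "\<And>n. p n = d_seq n / real ((n - 1) choose (r - 1))" and \<eta>: "\<eta> > 0"
  shows "(\<lambda>n. measure_pmf.prob (random_hypergraph r n (p n))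
           {E. real (longest_loose_path r {1..n} E) \<le> (min (path_beta r d) (path_gamma r d) + \<eta>) * real n})
      \<longlonglongrightarrow> 1"
proof -
  define N where "N n = (n - 1) choose (r - 1)" for n
  define \<rho> where "\<rho> n k = reach_bound r (p n) (N n) k" for n k
  define q where "q n k = branch_bound r (p n) (N n) k" for n k
  define hat where "hat x = 1 - (1 - x) ^ (r - 1)" for x :: real
  have N_top: "filterlim (\<lambda>n. real (N n)) at_top sequentially"
    unfolding N_def using r by (intro choose_at_top) auto
  have N_pos: "\<forall>\<^sub>F n in sequentially. N n > 0"
    using filterlim_at_top_dense[THEN iffD1, OF N_top, rule_format, of 0] by simp
  have pN: "\<forall>\<^sub>F n in sequentially. d_seq n = real (N n) * p n"
    using N_pos by eventually_elim (simp add: p_def N_def)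
  have pN_lim: "(\<lambda>n. real (N n) * p n) \<longlonglongrightarrow> d"
    using d_seq pN by (rule Lim_transform_eventually)
  have p_lim: "p \<longlonglongrightarrow> 0"
  proof -
    have "p = (\<lambda>n. d_seq n / real (N n))" by (rule ext) (simp add: p_def N_def)
    then show ?thesis using real_tendsto_divide_at_top[OF d_seq N_top] by simp
  qed
  have p01: "\<forall>\<^sub>F n in sequentially. 0 \<le> p n \<and> p n \<le> 1"
  proof -
    have "\<forall>\<^sub>F n in sequentially. d_seq n > 0" using order_tendstoD(1)[OF d_seq d] .
    moreover have "\<forall>\<^sub>F n in sequentially. p n < 1" using order_tendstoD(2)[OF p_lim, of 1] by simp
    ultimately show ?thesis by eventually_elim (simp add: p_def)
  qed
  have q01: "\<forall>\<^sub>F n in sequentially. 0 \<le> q n k \<and> q n k \<le> 1" for k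
    using p01 by eventually_elim (simp add: q_def branch_bound_bounds)
  have q_eq: "q n k = p n * hat (\<rho> n k)" for n k
    by (simp add: q_def \<rho>_def hat_def branch_bound_def)
  have q_lims: "(\<lambda>n. q n k) \<longlonglongrightarrow> 0" "(\<lambda>n. real (N n) * q n k) \<longlonglongrightarrow> d * hat (rho_approx r d k)"
    if "(\<lambda>n. \<rho> n k) \<longlonglongrightarrow> rho_approx r d k" for k
  proof -
    have h: "(\<lambda>n. hat (\<rho> n k)) \<longlonglongrightarrow> hat (rho_approx r d k)"
      unfolding hat_def by (intro tendsto_intros that)
    show "(\<lambda>n. q n k) \<longlonglongrightarrow> 0" unfolding q_eq using tendsto_mult[OF p_lim h] by simp
    show "(\<lambda>n. real (N n) * q n k) \<longlonglongrightarrow> d * hat (rho_approx r d k)"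
      unfolding q_eq using tendsto_mult[OF pN_lim h] by (simp add: mult.assoc)
  qed
  have \<rho>_lim: "(\<lambda>n. \<rho> n k) \<longlonglongrightarrow> rho_approx r d k" for k
  proof (induction k)
    case (Suc k)
    have "(\<lambda>n. 1 - (1 - q n k) ^ N n) \<longlonglongrightarrow> 1 - exp (- (d * hat (rho_approx r d k)))"
      by (intro tendsto_diff tendsto_const power_one_minus_tendsto_exp q01 q_lims Suc.IH)
    then show ?case
      by (simp add: \<rho>_def q_def branch_bound_def F_fun_def hat_def)
  qed (simp add: \<rho>_def)

  have "(\<lambda>k. d / real r * two_or_more r (rho_approx r d k)) \<longlonglongrightarrow> path_beta r d"
    unfolding two_or_more_def path_beta_def by (intro tendsto_intros rho_approx_tendsto d)
  then have "\<forall>\<^sub>F k in sequentially. d / real r * two_or_more r (rho_approx r d k) < path_beta r d + \<eta> / 2"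
    using \<eta> by (intro order_tendstoD(2)) auto
  moreover have "(\<lambda>k. 1 - exp (- (d * hat (rho_approx r d k)))
        - d * hat (rho_approx r d k) * exp (- (d * hat (rho_approx r d k)))) \<longlonglongrightarrow> path_gamma r d"
    unfolding path_gamma_def rho_hat_star_def hat_def mult_minus_left
    by (intro tendsto_intros rho_approx_tendsto d)
  then have "\<forall>\<^sub>F k in sequentially. 1 - exp (- (d * hat (rho_approx r d k)))
        - d * hat (rho_approx r d k) * exp (- (d * hat (rho_approx r d k))) < path_gamma r d + \<eta> / 2"
    using \<eta> by (intro order_tendstoD(2)) auto
  \<comment> \<open>The depth is fixed here for both constants at once; from now on only
    \<open>n\<close> varies.\<close>
  ultimately have "\<exists>k. d / real r * two_or_more r (rho_approx r d k) < path_beta r d + \<eta> / 2 \<and>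
      1 - exp (- (d * hat (rho_approx r d k)))
        - d * hat (rho_approx r d k) * exp (- (d * hat (rho_approx r d k))) < path_gamma r d + \<eta> / 2"
    by (intro eventually_happens' eventually_conj) auto
  then obtain k where k: "d / real r * two_or_more r (rho_approx r d k) < path_beta r d + \<eta> / 2"
      "1 - exp (- (d * hat (rho_approx r d k)))
        - d * hat (rho_approx r d k) * exp (- (d * hat (rho_approx r d k))) < path_gamma r d + \<eta> / 2"
    by (elim exE conjE)

  define c where "c n = conn_sum r (p n * real (N n)) (2 * k + 3)" for n
  \<comment> \<open>The factor \<open>16 / \<eta>\<^sup>2 * (1 / n)\<close> is
    \<open>n / t\<^sup>2\<close> for \<open>t = \<eta> / 4 * n\<close>: a variance of order
    \<open>n\<close> against a squared deviation of order \<open>n\<^sup>2\<close>.\<close>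
  define err where "err n = (real (N n) * p n / real r + (real (N n) * p n)\<^sup>2 * c n + c n) * (16 / \<eta>\<^sup>2) * (1 / real n)" for n
  have c_lim: "c \<longlonglongrightarrow> (\<Sum>m\<le>2 * k + 3. (real r * d) ^ m)"
  proof -
    have "c = (\<lambda>n. \<Sum>m\<le>2 * k + 3. (real r * (real (N n) * p n)) ^ m)"
      by (rule ext) (simp add: c_def conn_sum_def mult.commute)
    then show ?thesis by (simp only:) (intro tendsto_intros pN_lim)
  qed
  have "err \<longlonglongrightarrow> (d / real r + d\<^sup>2 * (\<Sum>m\<le>2 * k + 3. (real r * d) ^ m) + (\<Sum>m\<le>2 * k + 3. (real r * d) ^ m)) * (16 / \<eta>\<^sup>2) * 0"
    unfolding err_def using r by (intro tendsto_intros pN_lim c_lim lim_1_over_n) auto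
  then have lower: "(\<lambda>n. 1 - err n) \<longlonglongrightarrow> 1"
    using tendsto_diff[OF tendsto_const, of err 0 sequentially "1::real"] by simp
  have "(\<lambda>n. real (N n) * p n / real r * two_or_more r (\<rho> n k)) \<longlonglongrightarrow> d / real r * two_or_more r (rho_approx r d k)"
    unfolding two_or_more_def using r by (intro tendsto_intros pN_lim \<rho>_lim) auto
  from order_tendstoD(2)[OF this k(1)]
  have ev1: "\<forall>\<^sub>F n in sequentially. real (N n) * p n / real r * two_or_more r (\<rho> n k) < path_beta r d + \<eta> / 2" .
  have "(\<lambda>n. two_or_more (N n) (q n k)) \<longlonglongrightarrow> 1 - exp (- (d * hat (rho_approx r d k)))
        - d * hat (rho_approx r d k) * exp (- (d * hat (rho_approx r d k)))"
    by (intro two_or_more_tendsto_poisson q01 q_lims \<rho>_lim N_pos)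
  from order_tendstoD(2)[OF this k(2)]
  have ev2: "\<forall>\<^sub>F n in sequentially. two_or_more (N n) (q n k) < path_gamma r d + \<eta> / 2" .
  have ev3: "\<forall>\<^sub>F n in sequentially. real (2 * k + 1) * (4 / \<eta>) \<le> real n"
    using filterlim_real_sequentially unfolding filterlim_at_top by blast

  have "\<forall>\<^sub>F n in sequentially. 1 - err n \<le> measure_pmf.prob (random_hypergraph r n (p n))
     {E. real (longest_loose_path r {1..n} E) \<le> (min (path_beta r d) (path_gamma r d) + \<eta>) * real n}"
    using p01 ev1 ev2 ev3 eventually_ge_at_top[of 1]
  proof eventually_elim
    case (elim n)
    let ?X = "r_subsets r n"
    have n0: "real n > 0" using elim(5) by simp
    \<comment> \<open>The origin of \<open>d / r\<close> in \<open>path_beta\<close>: the expected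
      number of edges is \<open>n * (N n * p n) / r\<close>.\<close>
    have X: "real (card ?X) = real n * real (N n) / real r"
      using card_r_subsets_times[of r n] r by (simp add: N_def field_simps)
    define a where "a = real (card ?X) * (p n * two_or_more r (\<rho> n k))"
    define b where "b = real n * two_or_more (N n) (q n k)"
    define C where "C = real n * c n"
    define t where "t = \<eta> / 4 * real n"
    have t: "t > 0" using \<eta> n0 by (simp add: t_def)
    have "(p n * real (card ?X) + (p n * real (N n))\<^sup>2 * C + C) / t\<^sup>2 = err n"
      using n0 \<eta> r unfolding X C_def t_def err_def
      by (simp add: field_simps power2_eq_square)
    then have "1 - err n \<le> measure_pmf.prob (random_hypergraph r n (p n))
          {E. real (longest_loose_path r {1..n} E) \<le> min a b + t + real (2 * k + 1)}"
      using prob_longest_loose_path_le[of r n "p n" t k] r elim(1,5) t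
      unfolding a_def b_def C_def c_def q_def \<rho>_def N_def by simp
    also have "\<dots> \<le> measure_pmf.prob (random_hypergraph r n (p n))
       {E. real (longest_loose_path r {1..n} E) \<le> (min (path_beta r d) (path_gamma r d) + \<eta>) * real n}"
    proof (rule prob_mono)
      fix E assume E: "real (longest_loose_path r {1..n} E) \<le> min a b + t + real (2 * k + 1)"
      have "a = real n * (real (N n) * p n / real r * two_or_more r (\<rho> n k))"
        unfolding a_def X by simp
      also have "\<dots> \<le> real n * (path_beta r d + \<eta> / 2)"
        using elim(2) by (intro mult_left_mono) auto
      finally have a: "a \<le> real n * (path_beta r d + \<eta> / 2)" .
      have b: "b \<le> real n * (path_gamma r d + \<eta> / 2)"
        unfolding b_def using elim(3) by (intro mult_left_mono) auto
      have ab: "min a b \<le> real n * (min (path_beta r d) (path_gamma r d) + \<eta> / 2)"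
        using a b by (simp add: min_def split: if_splits)
      have "real (2 * k + 1) \<le> \<eta> / 4 * real n"
        using elim(4) \<eta> by (simp add: field_simps)
      then have "min a b + t + real (2 * k + 1) \<le> real n * (min (path_beta r d) (path_gamma r d) + \<eta> / 2) + \<eta> / 4 * real n + \<eta> / 4 * real n"
        using ab unfolding t_def by linarith
      also have "\<dots> = (min (path_beta r d) (path_gamma r d) + \<eta>) * real n"
        by (simp add: algebra_simps)
      finally show "real (longest_loose_path r {1..n} E) \<le> (min (path_beta r d) (path_gamma r d) + \<eta>) * real n"
        using E by linarith
    qed
    finally show ?case .
  qed
  then show ?thesis
    by (rule tendsto_sandwich[OF _ _ lower tendsto_const]) simp
qed

theorem corollary1p7:
  fixes r :: nat and d :: real and d_seq :: "nat \<Rightarrow> real" and p :: "nat \<Rightarrow> real"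
  assumes "r \<ge> 3" and "d > 0" and "d_seq \<longlonglongrightarrow> d"
    and "\<And>n. p n = d_seq n / real ((n - 1) choose (r - 1))"
  shows "\<exists>\<epsilon> :: nat \<Rightarrow> real. \<epsilon> \<longlonglongrightarrow> 0 \<and>
    (\<lambda>n. measure_pmf.prob (random_hypergraph r n (p n))
           {E. real (longest_loose_path r {1..n} E) \<le> (min (path_beta r d) (path_gamma r d) + \<epsilon> n) * real n})
      \<longlonglongrightarrow> 1"
proof (rule exists_null_sequence_of_thresholds)
  fix n and x y :: real assume "x \<le> y"
  then have "(min (path_beta r d) (path_gamma r d) + x) * real n
      \<le> (min (path_beta r d) (path_gamma r d) + y) * real n"
    by (intro mult_right_mono) auto
  then show "measure_pmf.prob (random_hypergraph r n (p n))
      {E. real (longest_loose_path r {1..n} E) \<le> (min (path_beta r d) (path_gamma r d) + x) * real n}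
    \<le> measure_pmf.prob (random_hypergraph r n (p n))
      {E. real (longest_loose_path r {1..n} E) \<le> (min (path_beta r d) (path_gamma r d) + y) * real n}"
    by (intro prob_mono) linarith
qed (simp_all only: measure_nonneg measure_pmf.prob_le_1 longest_loose_path_linear_bound[OF assms])

end
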